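(* Let $p \geqslant 3$ be a prime. Let $H$ be a finite abelian $p$-group such that $\mathsf{D}(H) \leqslant 2\exp(H)-p^k$ for some integer $k\geqslant 0$ with $p^k \leqslant \exp(H)$, and let $a$ be a positive integer coprime to $p$. Then $G \simeq H\oplus C_{a}$ satisfies $$\mathsf{s}(G)\leqslant \mathsf{D}(H)+2\exp(G)-p^k-1.$$
   Context: $C_a$ denotes the cyclic group of order $a$. A sequence over a finite abelian group $G$ is a finite unordered list $S=g_1\cdots g_\ell$ of elements of $G$ with repetition allowed; $|S|=\ell$ is its length and $\sigma(S)=\sum_i g_i$ its sum; a subsequence is a sub-multiset. $\mathsf{D}(G)$ (Davenport constant) is the smallest positive integer $N$ such that every sequence over $G$ of length at least $N$ has a nonempty subsequence with sum $0$. $\mathsf{s}(G)$ (Erdős–Ginzburg–Ziv constant) is the smallest positive integer $N$ such that every sequence over $G$ of length at least $N$ has a subsequence $T$ with $\sigma(T)=0$ and $|T|=\exp(G)$. *)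

theory Defs
  imports "HOL-Algebra.Algebra" "HOL-Library.Multiset"
begin

text \<open>
  Abelian groups are \<^locale>\<open>comm_group\<close> records, hence written multiplicatively: the ``sum'' of a
  sequence is a product in the record, and ``sum 0'' reads ``product \<open>\<one>\<close>''.
  A sequence over \<open>G\<close> is a multiset with support in the carrier, a subsequence a sub-multiset.
\<close>

definition seq_over :: "('a, 'm) monoid_scheme \<Rightarrow> 'a multiset \<Rightarrow> bool" where
  "seq_over G S \<longleftrightarrow> set_mset S \<subseteq> carrier G"

definition seq_sum :: "('a, 'm) monoid_scheme \<Rightarrow> 'a multiset \<Rightarrow> 'a" where
  "seq_sum G S = (\<Otimes>\<^bsub>G\<^esub>x\<in>set_mset S. x [^]\<^bsub>G\<^esub> count S x)"

text \<open>
  In the next three definitions the \<open>LEAST\<close> is meaningful for finite abelian groups, where a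
  witness always exists.
\<close>

definition group_exp :: "('a, 'm) monoid_scheme \<Rightarrow> nat" where
  "group_exp G = (LEAST n. n > 0 \<and> (\<forall>x\<in>carrier G. x [^]\<^bsub>G\<^esub> n = \<one>\<^bsub>G\<^esub>))"

definition davenport :: "('a, 'm) monoid_scheme \<Rightarrow> nat" where
  "davenport G = (LEAST N. N > 0 \<and>
     (\<forall>S. seq_over G S \<and> size S \<ge> N \<longrightarrow>
        (\<exists>T. T \<subseteq># S \<and> T \<noteq> {#} \<and> seq_sum G T = \<one>\<^bsub>G\<^esub>)))"

definition egz_const :: "('a, 'm) monoid_scheme \<Rightarrow> nat" where
  "egz_const G = (LEAST N. N > 0 \<and>
     (\<forall>S. seq_over G S \<and> size S \<ge> N \<longrightarrow>
        (\<exists>T. T \<subseteq># S \<and> seq_sum G T = \<one>\<^bsub>G\<^esub> \<and> size T = group_exp G)))"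

end

theory Submission
  imports Defs "HOL-Number_Theory.Cong"
begin

text \<open>
  For a \<open>p\<close>-group \<open>H\<close>, a product of \<open>D(H)\<close> elements \<open>1 - g\<close> vanishes in the group algebra over the
  field with \<open>p\<close> elements: it suffices to check this on an independent generating set, where it
  is the pigeonhole principle combined with \<open>(1 - g)\<^sup>q = 1 - g\<^sup>q\<close> for powers \<open>q\<close> of \<open>p\<close>. The
  group algebra enters only through its action on integer-valued functions modulo \<open>p\<close>.
  Applied to \<open>H \<oplus> C\<^sub>n\<close> with \<open>n = exp(H)\<close>, this gives congruences modulo \<open>p\<close> between the numbers of
  zero-sum subsequences of lengths \<open>jn\<close> and \<open>jn - p\<^sup>k\<close>. As in Reiher's proof of the Kemnitz
  conjecture, they contradict the absence of a zero-sum subsequence of length \<open>n\<close>, so that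
  \<open>s(H) \<le> D(H) + 2n - p\<^sup>k - 1\<close>. Over \<open>H \<oplus> C\<^sub>a\<close> one then extracts \<open>2a - 1\<close> disjoint blocks of length
  \<open>n\<close> with sum zero in \<open>H\<close> and applies the Erdos-Ginzburg-Ziv theorem to their sums in \<open>C\<^sub>a\<close>.
\<close>

section \<open>Alternating sums over subsets\<close>

text \<open>Let \<open>g\<close> act on functions by sending \<open>f\<close> to the function with
  value \<open>f (x \<otimes> g)\<close> at \<open>x\<close>. This is then the value at
  \<open>x\<close> of the product of all \<open>1 - s i\<close>, \<open>i\<close> in
  \<open>I\<close>, applied to \<open>f\<close>.\<close>

definition (in comm_group) altsum :: "('i \<Rightarrow> 'a) \<Rightarrow> 'i set \<Rightarrow> ('a \<Rightarrow> int) \<Rightarrow> 'a \<Rightarrow> int" where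
  "altsum s I f x = (\<Sum>T\<in>Pow I. (-1) ^ card T * f (x \<otimes> finprod G s T))"

text \<open>Expresses that every product of at least \<open>N\<close> factors \<open>1 - g\<close>
  is zero in the group algebra over the field with \<open>p\<close> elements. Testing on all
  \<open>f\<close> and \<open>x\<close> replaces the algebra itself; the index type is fixed to
  \<open>nat\<close> because a definition cannot quantify over types.\<close>

definition (in comm_group) altsum_vanishes :: "nat \<Rightarrow> nat \<Rightarrow> bool" where
  "altsum_vanishes p N \<longleftrightarrow> (\<forall>(I::nat set) s f. \<forall>x\<in>carrier G.
     finite I \<longrightarrow> N \<le> card I \<longrightarrow> s \<in> I \<rightarrow> carrier G \<longrightarrow> [altsum s I f x = 0] (mod int p))"

text \<open>By absorption \<open>i * (p ^ j choose i)\<close> is a multiple of \<open>p ^ j\<close>,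
  so a binomial coefficient coprime to \<open>p\<close> would force \<open>p ^ j\<close> to divide
  the smaller number \<open>i\<close>.\<close>

lemma prime_dvd_choose_prime_power:
  assumes "Factorial_Ring.prime (p::nat)" "0 < i" "i < p ^ j"
  shows "p dvd (p ^ j choose i)"
proof (rule ccontr)
  assume "\<not> p dvd (p ^ j choose i)"
  then have "coprime (p ^ j) (p ^ j choose i)"
    using assms(1) by (simp add: prime_imp_coprime)
  moreover have "p ^ j dvd (p ^ j choose i) * i"
  proof -
    have "i * (p ^ j choose i) = p ^ j * (p ^ j - 1 choose (i - 1))"
      using assms by (intro times_binomial_minus1_eq) auto
    then show ?thesis by (metis dvd_triv_left mult.commute)
  qed
  ultimately have "p ^ j dvd i"
    using coprime_dvd_mult_right_iff by blast
  then show False using assms(2,3) by (auto dest: dvd_imp_le)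
qed

lemma sum_Pow_card:
  assumes "finite J"
  shows "(\<Sum>T\<in>Pow J. g (card T)) = (\<Sum>t\<le>card J. of_nat (card J choose t) * (g t :: int))"
proof -
  have "(\<Sum>T\<in>Pow J. g (card T)) = (\<Sum>t\<le>card J. \<Sum>T | T \<in> Pow J \<and> card T = t. g (card T))"
    using assms by (intro sum.group[symmetric]) (auto intro: card_mono)
  also have "\<dots> = (\<Sum>t\<le>card J. of_nat (card J choose t) * g t)"
  proof (rule sum.cong[OF refl])
    fix t assume "t \<in> {..card J}"
    have "(\<Sum>T | T \<in> Pow J \<and> card T = t. g (card T)) = (\<Sum>T | T \<subseteq> J \<and> card T = t. g t)"
      by (intro sum.cong) auto
    also have "\<dots> = of_nat (card J choose t) * g t"
      using n_subsets[OF assms] by simp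
    finally show "(\<Sum>T | T \<in> Pow J \<and> card T = t. g (card T)) = of_nat (card J choose t) * g t" .
  qed
  finally show ?thesis .
qed

context comm_group
begin

lemma altsum_empty [simp]: "x \<in> carrier G \<Longrightarrow> altsum s {} f x = f x"
  by (simp add: altsum_def)

text \<open>Multiplication by the factor \<open>1 - s i\<close>: subsets containing \<open>i\<close>
  carry one more sign and translate \<open>x\<close> by \<open>s i\<close>.\<close>

lemma altsum_insert:
  assumes "finite I" "i \<notin> I" "s \<in> insert i I \<rightarrow> carrier G" "x \<in> carrier G"
  shows "altsum s (insert i I) f x = altsum s I f x - altsum s I f (x \<otimes> s i)"
proof -
  have fin: "finite (Pow I)" "finite (insert i ` Pow I)" using assms by auto
  have disj: "Pow I \<inter> insert i ` Pow I = {}" using assms by auto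
  have inj: "inj_on (insert i) (Pow I)"
    using assms(2) by (intro inj_onI) (metis Pow_iff insert_ident subsetD)
  have "(\<Sum>T\<in>insert i ` Pow I. (-1) ^ card T * f (x \<otimes> finprod G s T))
      = (\<Sum>T\<in>Pow I. - ((-1) ^ card T * f (x \<otimes> s i \<otimes> finprod G s T)))"
  proof (subst sum.reindex[OF inj], rule sum.cong[OF refl])
    fix T assume "T \<in> Pow I"
    then have T: "finite T" "i \<notin> T" "s \<in> T \<rightarrow> carrier G" "s i \<in> carrier G"
      using assms finite_subset by auto
    then have "x \<otimes> finprod G s (insert i T) = x \<otimes> s i \<otimes> finprod G s T"
      using assms by (simp add: m_assoc)
    then show "((\<lambda>T. (-1) ^ card T * f (x \<otimes> finprod G s T)) \<circ> insert i) T
        = - ((-1) ^ card T * f (x \<otimes> s i \<otimes> finprod G s T))"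
      using T by simp
  qed
  then show ?thesis
    unfolding altsum_def Pow_insert using fin disj
    by (simp add: sum.union_disjoint sum_negf)
qed

lemma altsum_cong:
  assumes "\<And>i. i \<in> I \<Longrightarrow> s i = s' i" "\<And>i. i \<in> I \<Longrightarrow> s i \<in> carrier G"
  shows "altsum s I f x = altsum s' I f x"
  unfolding altsum_def
proof (rule sum.cong[OF refl])
  fix T assume "T \<in> Pow I"
  then have "finprod G s T = finprod G s' T"
    using assms by (intro finprod_cong') auto
  then show "(- 1) ^ card T * f (x \<otimes> finprod G s T) = (- 1) ^ card T * f (x \<otimes> finprod G s' T)"
    by simp
qed

text \<open>Multiplication in the group algebra is composition of operators: the factors from
  \<open>J\<close> act on the outcome of those from \<open>I\<close>.\<close>

lemma altsum_Un:
  assumes "finite I" "finite J" "I \<inter> J = {}" "s \<in> I \<union> J \<rightarrow> carrier G" "x \<in> carrier G"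
  shows "altsum s (I \<union> J) f x = altsum s J (altsum s I f) x"
  using assms(2,3,4,5)
proof (induction J arbitrary: x rule: finite_induct)
  case empty
  then show ?case by simp
next
  case (insert j J)
  have j: "s j \<in> carrier G" using insert.prems by auto
  have "altsum s (I \<union> insert j J) f x = altsum s (I \<union> J) f x - altsum s (I \<union> J) f (x \<otimes> s j)"
    using altsum_insert[of "I \<union> J" j s x f] insert assms(1) by simp
  also have "\<dots> = altsum s J (altsum s I f) x - altsum s J (altsum s I f) (x \<otimes> s j)"
    using insert j by simp
  also have "\<dots> = altsum s (insert j J) (altsum s I f) x"
    using altsum_insert[of J j s x "altsum s I f"] insert by simp
  finally show ?case .
qed

lemma altsum_cong_0:
  assumes "\<And>T. T \<subseteq> I \<Longrightarrow> [f (x \<otimes> finprod G s T) = 0] (mod m)"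
  shows "[altsum s I f x = 0] (mod m)"
proof -
  have "[altsum s I f x = (\<Sum>T\<in>Pow I. (-1) ^ card T * 0)] (mod m)"
    unfolding altsum_def using assms by (intro cong_sum cong_mult cong_refl) auto
  then show ?thesis by simp
qed

text \<open>A product with a vanishing subproduct vanishes: by \<open>altsum_Un\<close> it is a
  signed sum of translates of the smaller one.\<close>

lemma altsum_0_superset:
  assumes "finite I" "J \<subseteq> I" "s \<in> I \<rightarrow> carrier G" "x \<in> carrier G"
    and "\<And>y. y \<in> carrier G \<Longrightarrow> [altsum s J f y = 0] (mod m)"
  shows "[altsum s I f x = 0] (mod m)"
proof -
  have "altsum s (J \<union> (I - J)) f x = altsum s (I - J) (altsum s J f) x"
    using assms finite_subset by (intro altsum_Un) auto
  moreover have "J \<union> (I - J) = I" using assms by auto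
  moreover have "[altsum s (I - J) (altsum s J f) x = 0] (mod m)"
  proof (rule altsum_cong_0)
    fix T assume "T \<subseteq> I - J"
    then have "finprod G s T \<in> carrier G" using assms by (intro finprod_closed) auto
    then show "[altsum s J f (x \<otimes> finprod G s T) = 0] (mod m)"
      using assms(4,5) by simp
  qed
  ultimately show ?thesis by simp
qed

text \<open>Binomial expansion of \<open>1 - b\<close> to the power \<open>p ^ j\<close>: a subset
  contributes through its size only, and \<open>p\<close> divides all binomial coefficients except
  the first and the last. The sign stays explicit so that \<open>p = 2\<close> is covered.\<close>

lemma altsum_const_prime_power:
  assumes p: "Factorial_Ring.prime p" and J: "finite J" "card J = p ^ j"
    and s: "\<And>i. i \<in> J \<Longrightarrow> s i = b" and b: "b \<in> carrier G" and x: "x \<in> carrier G"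
  shows "[altsum s J f x = f x + (-1) ^ (p ^ j) * f (x \<otimes> b [^] (p ^ j))] (mod int p)"
proof -
  define q where "q = p ^ j"
  have q: "0 < q" using p by (simp add: q_def prime_gt_0_nat)
  define g where "g t = (-1) ^ t * f (x \<otimes> b [^] t)" for t :: nat
  have "altsum s J f x = (\<Sum>T\<in>Pow J. g (card T))"
    unfolding altsum_def
  proof (rule sum.cong[OF refl])
    fix T assume T: "T \<in> Pow J"
    have "finprod G s T = finprod G (\<lambda>_. b) T"
      using T s b by (intro finprod_cong') auto
    also have "\<dots> = b [^] card T" using b by (intro finprod_const) auto
    finally show "(-1) ^ card T * f (x \<otimes> finprod G s T) = g (card T)"
      by (simp add: g_def)
  qed
  also have "\<dots> = (\<Sum>t\<le>q. of_nat (q choose t) * g t)"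
    using sum_Pow_card[OF J(1)] J(2) by (simp add: q_def)
  also have "\<dots> = g 0 + g q + (\<Sum>t\<in>{..q} - {0, q}. of_nat (q choose t) * g t)"
    using q by (subst sum.subset_diff[of "{0,q}"]) auto
  finally have eq: "altsum s J f x = g 0 + g q + (\<Sum>t\<in>{..q} - {0, q}. of_nat (q choose t) * g t)" .
  have "int p dvd (\<Sum>t\<in>{..q} - {0, q}. of_nat (q choose t) * g t)"
  proof (rule dvd_sum)
    fix t assume "t \<in> {..q} - {0, q}"
    then have "p dvd (q choose t)"
      unfolding q_def using p by (intro prime_dvd_choose_prime_power) auto
    then show "int p dvd of_nat (q choose t) * g t" by simp
  qed
  then have "[altsum s J f x = g 0 + g q + 0] (mod int p)"
    unfolding eq by (intro cong_add cong_refl) (simp add: cong_0_iff)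
  then show ?thesis using x by (simp add: g_def q_def)
qed

text \<open>By the expansion, \<open>p ^ j\<close> equal factors act as multiplication by
  \<open>1 + (-1) ^ (p ^ j)\<close>, which is 0 for odd \<open>p\<close> and either 0 or 2 for
  \<open>p = 2\<close>.\<close>

lemma altsum_const_0:
  assumes p: "Factorial_Ring.prime p" and I: "finite I" "p ^ j \<le> card {i \<in> I. s i = b}"
    and s: "s \<in> I \<rightarrow> carrier G" and b: "b \<in> carrier G" "b [^] (p ^ j) = \<one>"
    and x: "x \<in> carrier G"
  shows "[altsum s I f x = 0] (mod int p)"
proof -
  obtain J where J: "J \<subseteq> {i \<in> I. s i = b}" "card J = p ^ j" "finite J"
    using obtain_subset_with_card_n[OF I(2)] by blast
  show ?thesis
  proof (rule altsum_0_superset[OF I(1) _ s x])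
    show "J \<subseteq> I" using J by auto
    fix y assume y: "y \<in> carrier G"
    have "[altsum s J f y = f y + (-1) ^ (p ^ j) * f (y \<otimes> b [^] (p ^ j))] (mod int p)"
      using J y b p by (intro altsum_const_prime_power) auto
    also have "f y + (-1) ^ (p ^ j) * f (y \<otimes> b [^] (p ^ j)) = (1 + (-1) ^ (p ^ j)) * f y"
      using b y by (simp add: algebra_simps)
    also have "[\<dots> = 0] (mod int p)"
    proof (cases "odd p")
      case True
      then show ?thesis by simp
    next
      case False
      then have "p = 2" using p primes_dvd_imp_eq[OF two_is_prime_nat p] by simp
      then show ?thesis
        by (cases "even (p ^ j)") (simp_all add: cong_0_iff)
    qed
    finally show "[altsum s J f y = 0] (mod int p)" .
  qed
qed

text \<open>Factors are exchanged one at a time. Since \<open>1 - gh = (1 - g) + g (1 - h)\<close>,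
  the elements \<open>g\<close> for which \<open>1 - g\<close> annihilates a fixed product form a
  subgroup, so it suffices that this subgroup contains \<open>B\<close>.\<close>

lemma altsum_0_generate:
  assumes B: "B \<subseteq> carrier G" "generate G B = carrier G" and I: "finite I"
    and B0: "\<And>s f x. \<lbrakk>s \<in> I \<rightarrow> B; x \<in> carrier G\<rbrakk> \<Longrightarrow> [altsum s I f x = 0] (mod m)"
    and s: "s \<in> I \<rightarrow> carrier G" and x: "x \<in> carrier G"
  shows "[altsum s I f x = 0] (mod m)"
proof -
  \<comment> \<open>\<open>A\<close> holds the positions whose factor is not yet known to lie in
    \<open>B\<close>; the induction frees one of them at a time.\<close>
  have "\<lbrakk>A \<subseteq> I; s \<in> A \<rightarrow> carrier G; s \<in> I - A \<rightarrow> B; x \<in> carrier G\<rbrakk>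
      \<Longrightarrow> [altsum s I f x = 0] (mod m)" if "finite A" for A s f x
    using that
  proof (induction A arbitrary: s f x rule: finite_induct)
    case empty
    then show ?case by (intro B0) auto
  next
    case (insert i A)
    define J where "J = I - {i}"
    have J: "finite J" "i \<notin> J" "I = insert i J" using insert I by (auto simp: J_def)
    have sJ: "s \<in> J \<rightarrow> carrier G"
      using insert.prems B(1) by (auto simp: J_def Pi_def)
    \<comment> \<open>\<open>K\<close> is the set of periods modulo \<open>m\<close> of the function
      \<open>altsum s J f\<close>. By \<open>step\<close>, \<open>g\<close> is a period exactly if
      the full product with \<open>g\<close> at position \<open>i\<close> vanishes at every
      point.\<close>
    define K where "K = {g \<in> carrier G. \<forall>y\<in>carrier G. [altsum s J f y = altsum s J f (y \<otimes> g)] (mod m)}"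
    have step: "altsum (s(i := g)) I f y = altsum s J f y - altsum s J f (y \<otimes> g)"
      if "g \<in> carrier G" "y \<in> carrier G" for g y
    proof -
      have "altsum (s(i := g)) J f z = altsum s J f z" for z
        using sJ J by (intro altsum_cong) auto
      then show ?thesis
        unfolding J(3) using J sJ that by (subst altsum_insert) auto
    qed
    have "generate G B \<subseteq> K"
    proof
      fix g assume "g \<in> generate G B"
      then show "g \<in> K"
      proof induction
        case one
        then show ?case by (simp add: K_def)
      next
        case (incl h)
        have "[altsum (s(i := h)) I f y = 0] (mod m)" if "y \<in> carrier G" for y
          using insert incl that B(1) by (intro insert.IH) (auto simp: Pi_def)
        then show ?case using step[of h] incl B(1) by (auto simp: K_def cong_diff_iff_cong_0)
      next
        case (inv h)
        have h: "h \<in> carrier G" using inv B(1) by auto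
        have "[altsum (s(i := h)) I f y = 0] (mod m)" if "y \<in> carrier G" for y
          using insert inv that B(1) by (intro insert.IH) (auto simp: Pi_def)
        then have *: "[altsum s J f y = altsum s J f (y \<otimes> h)] (mod m)" if "y \<in> carrier G" for y
          using step[of h] h that by (auto simp: cong_diff_iff_cong_0)
        have "[altsum s J f y = altsum s J f (y \<otimes> inv h)] (mod m)" if "y \<in> carrier G" for y
          using *[of "y \<otimes> inv h"] h that by (simp add: m_assoc cong_sym)
        then show ?case using h by (simp add: K_def)
      next
        case (eng g h)
        have gh: "g \<in> carrier G" "h \<in> carrier G" using eng by (auto simp: K_def)
        have "[altsum s J f y = altsum s J f (y \<otimes> (g \<otimes> h))] (mod m)" if "y \<in> carrier G" for y
        proof -
          have "[altsum s J f y = altsum s J f (y \<otimes> g)] (mod m)"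
            using eng that by (auto simp: K_def)
          also have "[altsum s J f (y \<otimes> g) = altsum s J f (y \<otimes> g \<otimes> h)] (mod m)"
            using eng gh that by (auto simp: K_def)
          finally show ?thesis using gh that by (simp add: m_assoc)
        qed
        then show ?case using gh by (simp add: K_def)
      qed
    qed
    moreover have si: "s i \<in> carrier G" using insert.prems by auto
    ultimately have "[altsum s J f x = altsum s J f (x \<otimes> s i)] (mod m)"
      using B(2) insert.prems by (auto simp: K_def)
    then show ?case
      using step[OF si insert.prems(4)] by (simp add: cong_diff_iff_cong_0)
  qed
  from this[OF I, of s x f] show ?thesis using s x by auto
qed

end

section \<open>The Davenport constant of a finite abelian \<open>p\<close>-group\<close>

lemma (in comm_group) finprod_mem_subgroup:
  assumes "subgroup K G" "finite A" "\<And>a. a \<in> A \<Longrightarrow> f a \<in> K"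
  shows "finprod G f A \<in> K"
  using assms(2,3)
proof (induction A rule: finite_induct)
  case empty
  then show ?case using assms(1) by (simp add: subgroup.one_closed)
next
  case (insert a A)
  have "f \<in> insert a A \<rightarrow> carrier G"
    using insert.prems assms(1) by (auto dest: subgroup.mem_carrier)
  then show ?case using insert assms(1) by (simp add: subgroup.m_closed)
qed

lemma (in comm_group) finprod_pow:
  assumes "f \<in> A \<rightarrow> carrier G"
  shows "finprod G f A [^] (n::nat) = finprod G (\<lambda>a. f a [^] n) A"
  using assms
proof (induction A rule: infinite_finite_induct)
  case (insert a A)
  then have "(\<lambda>a. f a [^] n) \<in> insert a A \<rightarrow> carrier G" by auto
  then show ?case using insert by (simp add: nat_pow_distrib)
qed auto

lemma (in group) ord_eq_prime_power:
  assumes "Factorial_Ring.prime (p :: nat)" "x \<in> carrier G" "x [^] (p ^ e) = \<one>"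
  obtains j where "ord x = p ^ j"
  using assms divides_primepow_nat[OF assms(1), of "ord x" e] pow_eq_id by blast

text \<open>A generating set minimizing the sum of the orders is independent: a nontrivial relation
  would allow replacing a generator by an element of smaller order.\<close>

lemma (in comm_group) exists_independent_generators:
  assumes p: "Factorial_Ring.prime (p :: nat)" and fin: "finite (carrier G)"
    and pg: "\<And>x. x \<in> carrier G \<Longrightarrow> x [^] (p ^ e) = \<one>"
  obtains B where "B \<subseteq> carrier G" "generate G B = carrier G"
    and "\<And>m. finprod G (\<lambda>b. b [^] (m b :: nat)) B = \<one> \<Longrightarrow> \<forall>b\<in>B. ord b dvd m b"
proof -
  define P where "P B \<longleftrightarrow> B \<subseteq> carrier G \<and> generate G B = carrier G" for B
  have "generate G (carrier G) = carrier G"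
    using generate_in_carrier[OF subset_refl] by (auto intro: generate.incl)
  then have "P (carrier G)" by (simp add: P_def)
  then obtain B where B: "P B" and min: "\<And>B'. P B' \<Longrightarrow> (\<Sum>b\<in>B. ord b) \<le> (\<Sum>b\<in>B'. ord b)"
    using ex_has_least_nat[of P "carrier G" "\<lambda>B. \<Sum>b\<in>B. ord b"] by metis
  have BG: "B \<subseteq> carrier G" and gen: "generate G B = carrier G" using B by (auto simp: P_def)
  have finB: "finite B" using BG fin finite_subset by blast
  have "\<forall>b\<in>B. ord b dvd m b" if prod1: "finprod G (\<lambda>b. b [^] (m b :: nat)) B = \<one>" for m
  proof (rule ccontr)
    \<comment> \<open>The generators at which the given relation is nontrivial; all others
      contribute the neutral element.\<close>
    define E where "E = {b \<in> B. \<not> ord b dvd m b}"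
    assume "\<not> (\<forall>b\<in>B. ord b dvd m b)"
    then have "E \<noteq> {}" by (auto simp: E_def)
    then obtain c where c: "c \<in> E"
      and cmin: "\<And>b. b \<in> E \<Longrightarrow> multiplicity p (m c) \<le> multiplicity p (m b)"
      using ex_has_least_nat[of "\<lambda>b. b \<in> E" _ "\<lambda>b. multiplicity p (m b)"] by blast
    \<comment> \<open>The least \<open>p\<close>-adic valuation of the exponents on
      \<open>E\<close>, attained at \<open>c\<close>. Extracting \<open>p ^ v\<close> from all of
      them leaves an exponent \<open>w c\<close> coprime to \<open>p\<close> and an element
      \<open>h\<close> whose \<open>p ^ v\<close>-th power is trivial.\<close>
    define v where "v = multiplicity p (m c)"
    define w where "w b = (if b \<in> E then m b div p ^ v else 0)" for b
    have cB: "c \<in> B" "c \<in> carrier G" using c BG by (auto simp: E_def)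
    have "m c \<noteq> 0" using c unfolding E_def by (metis (mono_tags) dvd_0_right mem_Collect_eq)
    have mE: "m b = w b * p ^ v" if "b \<in> E" for b
    proof -
      have "p ^ v dvd m b" using cmin[OF that] multiplicity_dvd' unfolding v_def by blast
      then show ?thesis using that by (simp add: w_def)
    qed
    have cop: "coprime (w c) p"
    proof -
      have "\<not> p dvd w c"
        using multiplicity_decompose[OF \<open>m c \<noteq> 0\<close>, of p] prime_gt_1_nat[OF p] c
        by (simp add: w_def v_def)
      then show ?thesis using p by (simp add: coprime_commute prime_imp_coprime)
    qed
    define h where "h = finprod G (\<lambda>b. b [^] w b) B"
    have h: "h \<in> carrier G" unfolding h_def using BG by (intro finprod_closed) auto
    have "h [^] (p ^ v) = finprod G (\<lambda>b. (b [^] w b) [^] (p ^ v)) B"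
      unfolding h_def using BG by (intro finprod_pow) auto
    also have "\<dots> = finprod G (\<lambda>b. b [^] m b) B"
    proof (rule finprod_cong')
      fix b assume b: "b \<in> B"
      then have bG: "b \<in> carrier G" using BG by auto
      show "(b [^] w b) [^] (p ^ v) = b [^] m b"
      proof (cases "b \<in> E")
        case True
        then show ?thesis using bG mE by (simp add: nat_pow_pow)
      next
        case False
        then have "b [^] m b = \<one>" using b bG by (simp add: E_def pow_eq_id)
        then show ?thesis using False by (simp add: w_def)
      qed
    qed (use BG in auto)
    finally have hpow: "h [^] (p ^ v) = \<one>" using prod1 by simp
    have "ord h \<le> p ^ v"
      using hpow h p by (intro dvd_imp_le) (auto simp: pow_eq_id prime_gt_0_nat)
    moreover obtain j where j: "ord c = p ^ j"
      using ord_eq_prime_power[OF p cB(2) pg[OF cB(2)]] .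
    moreover have "v < j"
    proof (rule ccontr)
      assume "\<not> v < j"
      then have "p ^ j dvd m c" using mE[OF c] by (simp add: le_imp_power_dvd)
      then show False using c j by (auto simp: E_def)
    qed
    ultimately have ord_less: "ord h < ord c"
      using p by (metis le_less_trans power_strict_increasing prime_gt_1_nat)
    \<comment> \<open>The exchange of \<open>c\<close> for \<open>h\<close>, which has smaller
      order. The generator \<open>c\<close> is recovered from
      \<open>c [^] w c = h \<otimes> inv r\<close>, as \<open>w c\<close> is invertible modulo
      \<open>ord c\<close>.\<close>
    define B' where "B' = insert h (B - {c})"
    have B'G: "B' \<subseteq> carrier G" using BG h by (auto simp: B'_def)
    define K where "K = generate G B'"
    have K: "subgroup K G" unfolding K_def using B'G by (rule generate_is_subgroup)
    have KB: "b \<in> K" if "b \<in> B'" for b using that by (simp add: K_def generate.incl)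
    define r where "r = finprod G (\<lambda>b. b [^] w b) (B - {c})"
    have "r \<in> K" unfolding r_def
    proof (rule finprod_mem_subgroup[OF K])
      fix b assume "b \<in> B - {c}"
      then have "b \<in> K" by (intro KB) (auto simp: B'_def)
      then show "b [^] w b \<in> K"
        using subgroup_int_pow_closed[OF K, of b "int (w b)"] by (simp add: int_pow_int)
    qed (use finB in simp)
    then have r: "r \<in> carrier G" using K by (rule subgroup.mem_carrier[rotated])
    have "h = c [^] w c \<otimes> r"
    proof -
      have "h = finprod G (\<lambda>b. b [^] w b) (insert c (B - {c}))"
        unfolding h_def using cB by (simp add: insert_absorb)
      also have "\<dots> = c [^] w c \<otimes> r"
        unfolding r_def using finB BG cB by (intro finprod_insert) auto
      finally show ?thesis .
    qed
    then have "c [^] w c = h \<otimes> inv r" using r h cB by (simp add: m_assoc)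
    also have "\<dots> \<in> K"
      using \<open>r \<in> K\<close> KB[of h] K by (simp add: B'_def subgroup.m_closed subgroup.m_inv_closed)
    finally have cK: "c [^] w c \<in> K" .
    have "coprime (w c) (ord c)" using cop j by simp
    then obtain y where y: "[w c * y = Suc 0] (mod ord c)" using cong_solve_coprime_nat by blast
    have "int (ord c) dvd int (Suc 0) - int (w c * y)"
      using cong_int_iff[THEN iffD2, OF y] cong_iff_dvd_diff cong_sym by blast
    then have "c [^] (w c * y) = c [^] Suc 0"
      using int_pow_eq[OF cB(2), of "int (w c * y)" "int (Suc 0)"] by (simp only: int_pow_int)
    then have "c = (c [^] w c) [^] y" using cB by (simp add: nat_pow_pow)
    also have "\<dots> \<in> K"
      using subgroup_int_pow_closed[OF K cK, of "int y"] by (simp add: int_pow_int)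
    finally have "c \<in> K" .
    have "B \<subseteq> K" using KB \<open>c \<in> K\<close> by (auto simp: B'_def)
    then have "carrier G \<subseteq> K" using generate_subgroup_incl[OF _ K] gen by blast
    then have "P B'" using B'G generate_in_carrier[OF B'G] by (auto simp: P_def K_def)
    then have "(\<Sum>b\<in>B. ord b) \<le> (\<Sum>b\<in>B'. ord b)" by (rule min)
    \<comment> \<open>Only an inequality, since \<open>h\<close> may already belong to
      \<open>B - {c}\<close>.\<close>
    also have "\<dots> \<le> ord h + (\<Sum>b\<in>B - {c}. ord b)"
      unfolding B'_def using finB by (simp add: sum.insert_if)
    also have "\<dots> < ord c + (\<Sum>b\<in>B - {c}. ord b)" using ord_less by simp
    also have "\<dots> = (\<Sum>b\<in>B. ord b)" using finB cB by (simp add: sum.remove)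
    finally show False by simp
  qed
  then show thesis using BG gen that by blast
qed

text \<open>All factors may be taken from \<open>B\<close> by \<open>altsum_0_generate\<close>. By
  pigeonhole some \<open>b\<close> then occurs at least \<open>e b\<close> times, and those factors
  alone vanish by \<open>altsum_const_0\<close>.\<close>

lemma (in comm_group) altsum_vanishes_generators:
  assumes p: "Factorial_Ring.prime (p :: nat)" and B: "finite B" "B \<subseteq> carrier G" "generate G B = carrier G"
    and e: "\<And>b. b \<in> B \<Longrightarrow> 0 < e b \<and> b [^] e b = \<one> \<and> (\<exists>j. e b = p ^ j)"
  shows "altsum_vanishes p (1 + (\<Sum>b\<in>B. e b - 1))"
  unfolding altsum_vanishes_def
proof (intro allI ballI impI)
  fix I :: "nat set" and s f x
  assume I: "finite I" "1 + (\<Sum>b\<in>B. e b - 1) \<le> card I" and s: "s \<in> I \<rightarrow> carrier G"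
    and x: "x \<in> carrier G"
  show "[altsum s I f x = 0] (mod int p)"
  proof (rule altsum_0_generate[OF B(2,3) I(1) _ s x])
    fix s :: "nat \<Rightarrow> 'a" and f x assume s: "s \<in> I \<rightarrow> B" and x: "x \<in> carrier G"
    have "\<exists>b\<in>B. e b \<le> card {i \<in> I. s i = b}"
    proof (rule ccontr)
      assume "\<not> ?thesis"
      then have *: "card {i \<in> I. s i = b} \<le> e b - 1" if "b \<in> B" for b using that by force
      have "card I = (\<Sum>b\<in>B. card {i \<in> I. s i = b})"
        using sum.group[OF I(1) B(1), of s "\<lambda>_. 1 :: nat"] s by (simp add: image_subset_iff_funcset)
      also have "\<dots> \<le> (\<Sum>b\<in>B. e b - 1)" using * by (intro sum_mono) auto
      finally show False using I(2) by simp
    qed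
    then obtain b j where b: "b \<in> B" "e b \<le> card {i \<in> I. s i = b}" "b [^] e b = \<one>" "e b = p ^ j"
      using e by blast
    have sG: "s \<in> I \<rightarrow> carrier G" using s B(2) by auto
    show "[altsum s I f x = 0] (mod int p)"
      by (rule altsum_const_0[OF p I(1) _ sG _ _ x, of j b]) (use b B(2) in auto)
  qed
qed

section \<open>Sequences as multisets and as indexed families\<close>

lemma (in comm_group) seq_sum_eq_finprod:
  assumes "finite A" "set_mset M \<subseteq> A" "A \<subseteq> carrier G"
  shows "seq_sum G M = finprod G (\<lambda>x. x [^] count M x) A"
  unfolding seq_sum_def using assms
  by (intro finprod_mono_neutral_cong_left) (auto simp: not_in_iff)

lemma (in comm_group) seq_sum_add_mset:
  assumes "set_mset M \<subseteq> carrier G" "y \<in> carrier G"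
  shows "seq_sum G (add_mset y M) = y \<otimes> seq_sum G M"
proof -
  define A where "A = insert y (set_mset M)"
  have A: "finite A" "A \<subseteq> carrier G" "y \<in> A" using assms by (auto simp: A_def)
  have "seq_sum G (add_mset y M) = finprod G (\<lambda>x. x [^] count (add_mset y M) x) A"
    using A by (intro seq_sum_eq_finprod) (auto simp: A_def)
  also have "\<dots> = finprod G (\<lambda>x. (if x = y then y else \<one>) \<otimes> x [^] count M x) A"
    using A by (intro finprod_cong') (auto simp: subset_iff m_comm)
  also have "\<dots> = finprod G (\<lambda>x. if x = y then y else \<one>) A \<otimes> finprod G (\<lambda>x. x [^] count M x) A"
    using A by (intro finprod_multf) auto
  also have "finprod G (\<lambda>x. if x = y then y else \<one>) A = y"
    using finprod_singleton_swap[OF A(3,1), of "\<lambda>_. y"] A by auto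
  also have "finprod G (\<lambda>x. x [^] count M x) A = seq_sum G M"
    using A by (intro seq_sum_eq_finprod[symmetric]) (auto simp: A_def)
  finally show ?thesis .
qed

text \<open>Links multisets to sets of positions. All counting below is done with positions, where
  equal terms remain distinguishable.\<close>

lemma (in comm_group) seq_sum_image_mset:
  assumes "finite T" "s \<in> T \<rightarrow> carrier G"
  shows "seq_sum G (image_mset s (mset_set T)) = finprod G s T"
  using assms
proof (induction T rule: finite_induct)
  case empty
  then show ?case by (simp add: seq_sum_def)
next
  case (insert t T)
  then have "s ` T \<subseteq> carrier G" by auto
  then show ?case using insert by (simp add: seq_sum_add_mset)
qed

lemma image_mset_nth_subset:
  assumes "T \<subseteq> {..<length xs}"
  shows "image_mset ((!) xs) (mset_set T) \<subseteq># mset xs"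
proof -
  have "image_mset ((!) xs) (mset_set T) \<subseteq># image_mset ((!) xs) (mset_set {..<length xs})"
    using assms by (intro image_mset_subseteq_mono subset_imp_msubset_mset_set) auto
  also have "\<dots> = mset xs"
    using mset_map[of "(!) xs" "[0..<length xs]"] by (simp add: map_nth atLeast0LessThan)
  finally show ?thesis .
qed

text \<open>Evaluate the alternating sum of the indicator of the neutral element at the neutral
  element: the empty set contributes 1 and, without nonempty zero-sum subsets, nothing else does.
  But 1 is not 0 modulo \<open>p\<close>.\<close>

lemma (in comm_group) zero_sum_of_altsum_vanishes:
  assumes p: "p > 1" and N: "altsum_vanishes p N"
    and S: "seq_over G S" "N \<le> size S"
  shows "\<exists>T. T \<subseteq># S \<and> T \<noteq> {#} \<and> seq_sum G T = \<one>"
proof -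
  obtain xs where xs: "mset xs = S" using ex_mset by blast
  define I where "I = {..<length xs}"
  have s: "(!) xs \<in> I \<rightarrow> carrier G"
    using S(1) xs by (auto simp: I_def seq_over_def)
  have "\<exists>T\<subseteq>I. T \<noteq> {} \<and> finprod G ((!) xs) T = \<one>"
  proof (rule ccontr)
    assume *: "\<not> ?thesis"
    define f where "f x = (if x = \<one> then 1 else 0 :: int)" for x
    have "altsum ((!) xs) I f \<one> = (\<Sum>T\<in>Pow I. if T = {} then 1 else 0)"
      unfolding altsum_def
    proof (rule sum.cong[OF refl])
      fix T assume T: "T \<in> Pow I"
      then have "finprod G ((!) xs) T \<in> carrier G" using s by (intro finprod_closed) auto
      then show "(- 1) ^ card T * f (\<one> \<otimes> finprod G ((!) xs) T) = (if T = {} then 1 else 0)"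
        using * T by (auto simp: f_def)
    qed
    also have "\<dots> = 1" by (simp add: I_def)
    finally have "altsum ((!) xs) I f \<one> = 1" .
    moreover have "N \<le> card I" "finite I" using S(2) xs by (auto simp: I_def)
    ultimately have "[1 = 0] (mod int p)"
      using N s unfolding altsum_vanishes_def by (metis one_closed)
    then show False using p by (simp add: cong_def)
  qed
  then obtain T where T: "T \<subseteq> I" "T \<noteq> {}" "finprod G ((!) xs) T = \<one>" by blast
  have fT: "finite T" using T(1) finite_subset by (auto simp: I_def)
  have "seq_sum G (image_mset ((!) xs) (mset_set T)) = \<one>"
    using T s fT by (subst seq_sum_image_mset) auto
  moreover have "image_mset ((!) xs) (mset_set T) \<noteq> {#}" using T fT by (simp add: mset_set_empty_iff)
  ultimately show ?thesis
    using image_mset_nth_subset[of T xs] T(1) xs unfolding I_def by blast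
qed

text \<open>Olson's argument. For independent generators, vanishing holds from \<open>1 + L\<close>
  factors on, where \<open>L\<close> is the sum of all \<open>ord b - 1\<close>; a zero-sum free
  sequence of length \<open>L\<close> shows that \<open>davenport G\<close> is at least
  \<open>1 + L\<close>.\<close>

lemma (in comm_group) altsum_vanishes_davenport:
  assumes p: "Factorial_Ring.prime (p :: nat)" and fin: "finite (carrier G)"
    and pg: "\<And>x. x \<in> carrier G \<Longrightarrow> x [^] (p ^ e) = \<one>"
  shows "altsum_vanishes p (davenport G)" and "0 < davenport G"
proof -
  obtain B where B: "B \<subseteq> carrier G" "generate G B = carrier G"
    and indep: "\<And>m. finprod G (\<lambda>b. b [^] (m b :: nat)) B = \<one> \<Longrightarrow> \<forall>b\<in>B. ord b dvd m b"
    using exists_independent_generators[OF p fin pg] by blast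
  have finB: "finite B" using B fin finite_subset by blast
  define L where "L = (\<Sum>b\<in>B. ord b - 1)"
  have ordB: "0 < ord b \<and> b [^] ord b = \<one> \<and> (\<exists>j. ord b = p ^ j)" if "b \<in> B" for b
  proof -
    have b: "b \<in> carrier G" using that B by auto
    obtain j where "ord b = p ^ j" using ord_eq_prime_power[OF p b pg[OF b]] .
    then show ?thesis using b p pow_ord_eq_1[OF b] by (auto simp: prime_gt_0_nat)
  qed
  have van: "altsum_vanishes p (1 + L)"
    unfolding L_def using ordB by (intro altsum_vanishes_generators p finB B) auto
  define Q where "Q N \<longleftrightarrow> N > 0 \<and> (\<forall>S. seq_over G S \<and> size S \<ge> N \<longrightarrow>
        (\<exists>T. T \<subseteq># S \<and> T \<noteq> {#} \<and> seq_sum G T = \<one>))" for N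
  have D: "davenport G = (LEAST N. Q N)" by (simp add: davenport_def Q_def)
  \<comment> \<open>A witness, so that the \<open>LEAST\<close> defining \<open>davenport\<close>
    has its defining property.\<close>
  have "Q (1 + L)"
    unfolding Q_def using zero_sum_of_altsum_vanishes[OF prime_gt_1_nat[OF p] van] by auto
  then have QD: "Q (davenport G)" unfolding D by (rule LeastI)
  then show "0 < davenport G" by (simp add: Q_def)
  \<comment> \<open>The extremal sequence. By independence a zero-sum subsequence has each
    multiplicity divisible by \<open>ord b\<close>, while only \<open>ord b - 1\<close> copies of
    \<open>b\<close> are available.\<close>
  define S where "S = (\<Sum>b\<in>B. replicate_mset (ord b - 1) b)"
  have cnt: "count S b = (if b \<in> B then ord b - 1 else 0)" for b
    using finB by (simp add: S_def count_sum sum.delta)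
  have size: "size S = L"
    unfolding S_def L_def using finB by (induction B rule: finite_induct) auto
  have SB: "set_mset S \<subseteq> B"
    using cnt by (metis count_eq_zero_iff subsetI)
  have "L < davenport G"
  proof (rule ccontr)
    assume "\<not> L < davenport G"
    then obtain T where T: "T \<subseteq># S" "T \<noteq> {#}" "seq_sum G T = \<one>"
      using QD SB B(1) size unfolding Q_def seq_over_def by (meson not_less subset_trans)
    have TB: "set_mset T \<subseteq> B" using T SB set_mset_mono by blast
    have "finprod G (\<lambda>b. b [^] count T b) B = \<one>"
      using T(3) seq_sum_eq_finprod[OF finB TB B(1)] by simp
    then have dvd: "\<forall>b\<in>B. ord b dvd count T b" by (rule indep)
    obtain b where b: "b \<in># T" using T(2) by blast
    then have "b \<in> B" using TB by auto
    have "count T b \<le> ord b - 1" using T(1) cnt \<open>b \<in> B\<close> by (metis mset_subset_eq_count)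
    moreover have "ord b \<le> count T b" using dvd \<open>b \<in> B\<close> b by (intro dvd_imp_le) auto
    ultimately show False using ordB[OF \<open>b \<in> B\<close>] by linarith
  qed
  then show "altsum_vanishes p (davenport G)"
    using van unfolding altsum_vanishes_def by auto
qed

section \<open>Zero-sum subsets counted by length modulo \<open>n\<close>\<close>

lemma comm_group_DirProd:
  assumes "comm_group G" "comm_group K"
  shows "comm_group (G \<times>\<times> K)"
proof -
  interpret G: comm_group G by fact
  interpret K: comm_group K by fact
  interpret M: group "G \<times>\<times> K" by (rule DirProd_group) unfold_locales
  show ?thesis by (rule M.group_comm_groupI) (auto simp: G.m_comm K.m_comm)
qed

lemma finprod_DirProd:
  assumes "comm_group G" "comm_group K" "s \<in> T \<rightarrow> carrier (G \<times>\<times> K)"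
  shows "finprod (G \<times>\<times> K) s T = (finprod G (fst \<circ> s) T, finprod K (snd \<circ> s) T)"
proof -
  interpret G: comm_group G by fact
  interpret K: comm_group K by fact
  interpret M: comm_group "G \<times>\<times> K" by (rule comm_group_DirProd) fact+
  show ?thesis using assms(3)
  proof (induction T rule: infinite_finite_induct)
    case (insert t T)
    then have "s \<in> T \<rightarrow> carrier G \<times> carrier K" "s t \<in> carrier G \<times> carrier K" by auto
    moreover from this have "fst \<circ> s \<in> T \<rightarrow> carrier G" "snd \<circ> s \<in> T \<rightarrow> carrier K"
      "fst (s t) \<in> carrier G" "snd (s t) \<in> carrier K" by (auto simp: Pi_def mem_Times_iff)
    ultimately show ?case using insert by (simp add: mult_DirProd' comp_def)
  qed auto
qed

lemma pow_DirProd: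
  assumes "comm_group G" "comm_group K" "x \<in> carrier G" "y \<in> carrier K"
  shows "(x, y) [^]\<^bsub>G \<times>\<times> K\<^esub> (n::nat) = (x [^]\<^bsub>G\<^esub> n, y [^]\<^bsub>K\<^esub> n)"
proof -
  interpret G: comm_group G by fact
  interpret K: comm_group K by fact
  interpret M: comm_group "G \<times>\<times> K" by (rule comm_group_DirProd) fact+
  show ?thesis using assms(3,4) by (induction n) auto
qed

lemma finprod_integer_mod_group:
  assumes "n > 0" "z \<in> T \<rightarrow> carrier (integer_mod_group n)"
  shows "finprod (integer_mod_group n) z T = (\<Sum>t\<in>T. z t) mod int n"
proof -
  interpret Z: comm_group "integer_mod_group n" by simp
  show ?thesis using assms(2)
    by (induction T rule: infinite_finite_induct) (auto simp: mod_add_right_eq)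
qed

lemma mod_in_carrier_integer_mod_group:
  "n > 0 \<Longrightarrow> x mod int n \<in> carrier (integer_mod_group n)"
  by (simp add: carrier_integer_mod_group)

text \<open>Each \<open>(g, z)\<close> is \<open>(g, 0)\<close> times the \<open>z\<close>-th power
  of the extra generator. Writing \<open>1 mod int n\<close> keeps that generator in the carrier
  also for \<open>n = 1\<close>.\<close>

lemma (in comm_group) generate_DirProd_integer_mod_group:
  assumes n: "n > 0"
  defines "M \<equiv> G \<times>\<times> integer_mod_group n"
  shows "generate M (insert (\<one>, 1 mod int n) (carrier G \<times> {0})) = carrier M" (is "generate M ?B = _")
proof -
  interpret M: comm_group M unfolding M_def by (intro comm_group_DirProd comm_group_axioms) simp
  have B: "?B \<subseteq> carrier M"
    using n by (auto simp: M_def carrier_integer_mod_group)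
  have K: "subgroup (generate M ?B) M" by (rule M.generate_is_subgroup[OF B])
  have "x \<in> generate M ?B" if x: "x \<in> carrier M" for x
  proof -
    define g z where "g = fst x" and "z = nat (snd x)"
    have gz: "x = (g, int z)" "g \<in> carrier G" "z < n"
      using x n by (auto simp: g_def z_def M_def carrier_integer_mod_group)
    have "(\<one>, 1 mod int n) [^]\<^bsub>M\<^esub> z = (\<one>, int z * (1 mod int n) mod int n)"
      unfolding M_def using n
      by (subst pow_DirProd) (auto simp: comm_group_axioms mod_in_carrier_integer_mod_group)
    also have "int z * (1 mod int n) mod int n = int z mod int n" by (simp add: mod_mult_right_eq)
    finally have "x = (g, 0) \<otimes>\<^bsub>M\<^esub> (\<one>, 1 mod int n) [^]\<^bsub>M\<^esub> z"
      using gz by (simp add: M_def)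
    also have "\<dots> \<in> generate M ?B"
    proof (rule generate.eng)
      show "(g, 0) \<in> generate M ?B" using gz by (intro generate.incl) auto
      have "(\<one>, 1 mod int n) \<in> generate M ?B" by (intro generate.incl) auto
      then show "(\<one>, 1 mod int n) [^]\<^bsub>M\<^esub> z \<in> generate M ?B"
        using M.subgroup_int_pow_closed[OF K, of _ "int z"] by (simp add: int_pow_int)
    qed
    finally show ?thesis .
  qed
  then show ?thesis using M.generate_in_carrier[OF B] by blast
qed

text \<open>With factors from the generating set, either the cyclic generator \<open>c\<close>
  occurs at least \<open>n\<close> times and these factors vanish, or at least \<open>N\<close>
  factors come from the copy of \<open>G\<close> and vanish by hypothesis.\<close>

lemma (in comm_group) altsum_vanishes_DirProd_integer_mod_group:
  assumes p: "Factorial_Ring.prime (p :: nat)" and n: "n = p ^ e" and N: "altsum_vanishes p N"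
  shows "comm_group.altsum_vanishes (G \<times>\<times> integer_mod_group n) p (N + n - 1)"
proof -
  define M where "M = G \<times>\<times> integer_mod_group n"
  interpret Z: comm_group "integer_mod_group n" by simp
  interpret M: comm_group M unfolding M_def by (intro comm_group_DirProd comm_group_axioms) simp
  have n0: "n > 0" using n p by (simp add: prime_gt_0_nat)
  define c where "c = (\<one>, 1 mod int n)"
  define B where "B = insert c (carrier G \<times> {0})"
  have c: "c \<in> carrier M" using n0 by (simp add: c_def M_def mod_in_carrier_integer_mod_group)
  have BM: "B \<subseteq> carrier M" using c by (auto simp: B_def M_def)
  have gen: "generate M B = carrier M"
    unfolding B_def c_def M_def by (rule generate_DirProd_integer_mod_group[OF n0])
  have cn: "c [^]\<^bsub>M\<^esub> n = \<one>\<^bsub>M\<^esub>"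
    unfolding M_def c_def using n0
    by (subst pow_DirProd) (auto simp: comm_group_axioms mod_in_carrier_integer_mod_group)
  have "M.altsum_vanishes p (N + n - 1)"
    unfolding M.altsum_vanishes_def
  proof (intro allI ballI impI)
    fix I :: "nat set" and s f x
    assume I: "finite I" "N + n - 1 \<le> card I" and s: "s \<in> I \<rightarrow> carrier M" and x: "x \<in> carrier M"
    show "[M.altsum s I f x = 0] (mod int p)"
    proof (rule M.altsum_0_generate[OF BM gen I(1) _ s x])
      fix s f x assume s: "s \<in> I \<rightarrow> B" and x: "x \<in> carrier M"
      have sM: "s \<in> I \<rightarrow> carrier M" using s BM by auto
      define J where "J = {i \<in> I. s i \<noteq> c}"
      show "[M.altsum s I f x = 0] (mod int p)"
      proof (cases "n \<le> card {i \<in> I. s i = c}")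
        case True
        then show ?thesis
          by (intro M.altsum_const_0[OF p I(1) _ sM c _ x, of e]) (use n cn in auto)
      next
        case False
        have "card I = card J + card {i \<in> I. s i = c}"
          unfolding J_def using I(1) by (subst card_Un_disjoint[symmetric]) (auto intro: arg_cong[of _ _ card])
        then have cardJ: "N \<le> card J" using False I(2) by linarith
        have J: "finite J" "J \<subseteq> I" using I by (auto simp: J_def)
        have sJ: "s i \<in> carrier G \<times> {0}" if "i \<in> J" for i
          using s that by (auto simp: J_def B_def Pi_def)
        show ?thesis
        proof (rule M.altsum_0_superset[OF I(1) J(2) sM x])
          fix y assume y: "y \<in> carrier M"
          have yc: "fst y \<in> carrier G" "snd y \<in> carrier (integer_mod_group n)"
            using y by (auto simp: M_def)
          \<comment> \<open>The factors from \<open>J\<close> move only the first coordinate, so the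
            second one is a mere parameter of the test function.\<close>
          have "M.altsum s J f y = altsum (fst \<circ> s) J (\<lambda>g. f (g, snd y)) (fst y)"
            unfolding M.altsum_def altsum_def
          proof (rule sum.cong[OF refl])
            fix T assume T: "T \<in> Pow J"
            have "finprod M s T = (finprod G (fst \<circ> s) T, finprod (integer_mod_group n) (snd \<circ> s) T)"
              unfolding M_def using T sJ
              by (intro finprod_DirProd) (auto simp: comm_group_axioms subset_iff mem_Times_iff)
            also have "finprod (integer_mod_group n) (snd \<circ> s) T = 0"
              using T sJ Z.finprod_one_eqI[of T "snd \<circ> s"] by (auto simp: subset_iff mem_Times_iff)
            finally have "y \<otimes>\<^bsub>M\<^esub> finprod M s T = (fst y \<otimes> finprod G (fst \<circ> s) T, snd y)"
              using yc n0 by (simp add: M_def mult_DirProd' carrier_integer_mod_group comp_def)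
            then show "(- 1) ^ card T * f (y \<otimes>\<^bsub>M\<^esub> finprod M s T)
                = (- 1) ^ card T * f (fst y \<otimes> finprod G (fst \<circ> s) T, snd y)" by simp
          qed
          moreover have "fst \<circ> s \<in> J \<rightarrow> carrier G" using sJ by (auto simp: mem_Times_iff)
          ultimately show "[M.altsum s J f y = 0] (mod int p)"
            using N J(1) cardJ yc unfolding altsum_vanishes_def by simp
        qed
      qed
    qed
  qed
  then show ?thesis by (simp add: M_def)
qed

section \<open>Counting zero-sum subsets by length\<close>

definition (in comm_group) zero_sum_subsets :: "('i \<Rightarrow> 'a) \<Rightarrow> 'i set \<Rightarrow> nat \<Rightarrow> 'i set set" where
  "zero_sum_subsets s I m = {T. T \<subseteq> I \<and> card T = m \<and> finprod G s T = \<one>}"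

definition (in comm_group) signed_count :: "('i \<Rightarrow> 'a) \<Rightarrow> 'i set \<Rightarrow> nat \<Rightarrow> nat \<Rightarrow> int" where
  "signed_count s I n r =
     (\<Sum>T\<in>Pow I. if finprod G s T = \<one> \<and> card T mod n = r then (-1) ^ card T else 0)"

context comm_group
begin

text \<open>With second coordinate 1 attached to every term, sums in the product group record the
  length modulo \<open>n\<close>. The start \<open>t\<close> and the target \<open>r\<close> select
  the residue class \<open>r'\<close>; the cases used are \<open>r = 0\<close> with
  \<open>t = 0\<close> or \<open>t = q\<close>.\<close>

lemma altsum_DirProd_integer_mod_group:
  assumes n: "n > 0" and s: "s \<in> I \<rightarrow> carrier G" and I: "finite I" and tr: "t < n" "r < n"
    and s': "\<And>i. i \<in> I \<Longrightarrow> s' i = (s i, 1 mod int n)"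
    and r': "\<And>m. (t + m) mod n = r \<longleftrightarrow> m mod n = r'"
  shows "comm_group.altsum (G \<times>\<times> integer_mod_group n) s' I
      (\<lambda>y. if y = (\<one>, int r) then 1 else 0) (\<one>, int t) = signed_count s I n r'"
proof -
  define M where "M = G \<times>\<times> integer_mod_group n"
  interpret M: comm_group M unfolding M_def by (intro comm_group_DirProd comm_group_axioms) simp
  have "M.altsum s' I (\<lambda>y. if y = (\<one>, int r) then 1 else 0) (\<one>, int t) = signed_count s I n r'"
    unfolding M.altsum_def signed_count_def
  proof (rule sum.cong[OF refl])
    fix T assume T: "T \<in> Pow I"
    have sT: "s \<in> T \<rightarrow> carrier G" using T s by auto
    have "finprod M s' T = (finprod G (fst \<circ> s') T, finprod (integer_mod_group n) (snd \<circ> s') T)"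
      unfolding M_def using T s s' n
      by (intro finprod_DirProd)
         (auto simp: comm_group_axioms subset_iff mod_in_carrier_integer_mod_group)
    also have "finprod G (fst \<circ> s') T = finprod G s T"
      using T sT s' by (intro finprod_cong') auto
    also have "finprod (integer_mod_group n) (snd \<circ> s') T = (\<Sum>i\<in>T. (snd \<circ> s') i) mod int n"
      using T s' n by (intro finprod_integer_mod_group)
        (auto simp: subset_iff mod_in_carrier_integer_mod_group)
    also have "(\<Sum>i\<in>T. (snd \<circ> s') i) = (\<Sum>i\<in>T. 1 mod int n)"
      using T s' by (intro sum.cong) auto
    also have "\<dots> mod int n = int (card T) mod int n" by (simp add: mod_mult_right_eq)
    finally have "(\<one>, int t) \<otimes>\<^bsub>M\<^esub> finprod M s' T = (finprod G s T, int ((t + card T) mod n))"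
      using sT by (simp add: M_def mod_add_right_eq zmod_int)
    then have "(\<one>, int t) \<otimes>\<^bsub>M\<^esub> finprod M s' T = (\<one>, int r)
        \<longleftrightarrow> finprod G s T = \<one> \<and> card T mod n = r'"
      using r' by auto
    then show "(- 1) ^ card T * (if (\<one>, int t) \<otimes>\<^bsub>M\<^esub> finprod M s' T = (\<one>, int r) then 1 else 0)
        = (if finprod G s T = \<one> \<and> card T mod n = r' then (- 1) ^ card T else (0 :: int))" by simp
  qed
  then show ?thesis by (simp add: M_def)
qed

text \<open>The signed count is an alternating sum over \<open>G \<oplus> C_n\<close>, where
  \<open>N + n - 1\<close> factors suffice for vanishing.\<close>

lemma signed_count_0:
  assumes p: "Factorial_Ring.prime (p :: nat)" and n: "n = p ^ e" and N: "altsum_vanishes p N"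
    and I: "finite (I :: nat set)" "N + n - 1 \<le> card I" and s: "s \<in> I \<rightarrow> carrier G"
  shows "[signed_count s I n 0 = 0] (mod int p)"
proof -
  define M where "M = G \<times>\<times> integer_mod_group n"
  interpret M: comm_group M unfolding M_def by (intro comm_group_DirProd comm_group_axioms) simp
  have n0: "n > 0" using n p by (simp add: prime_gt_0_nat)
  have van: "M.altsum_vanishes p (N + n - 1)"
    unfolding M_def by (rule altsum_vanishes_DirProd_integer_mod_group[OF p n N])
  define s' where "s' i = (s i, 1 mod int n)" for i
  have "s' \<in> I \<rightarrow> carrier M"
    using s n0 by (auto simp: s'_def M_def mod_in_carrier_integer_mod_group)
  then have "[M.altsum s' I (\<lambda>y. if y = (\<one>, int 0) then 1 else 0) (\<one>, int 0) = 0] (mod int p)"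
    using van I unfolding M.altsum_vanishes_def by (simp add: M_def)
  also have "M.altsum s' I (\<lambda>y. if y = (\<one>, int 0) then 1 else 0) (\<one>, int 0) = signed_count s I n 0"
    unfolding M_def using n0 s I
    by (intro altsum_DirProd_integer_mod_group) (auto simp: s'_def)
  finally show ?thesis .
qed

text \<open>Obtained by appending \<open>q\<close> copies of the neutral element to the sequence.\<close>

lemma signed_count_shift:
  assumes p: "Factorial_Ring.prime (p :: nat)" "odd p" and n: "n = p ^ e" and q: "q = p ^ k" "q < n"
    and N: "altsum_vanishes p N"
    and I: "finite (I :: nat set)" "N + n - 1 \<le> card I + q" and s: "s \<in> I \<rightarrow> carrier G"
  shows "[signed_count s I n 0 = signed_count s I n (n - q)] (mod int p)"
proof -
  define M where "M = G \<times>\<times> integer_mod_group n"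
  interpret Z: comm_group "integer_mod_group n" by simp
  interpret M: comm_group M unfolding M_def by (intro comm_group_DirProd comm_group_axioms) simp
  have n0: "n > 0" using q by simp
  have q0: "q > 0" using q p by (simp add: prime_gt_0_nat)
  have van: "M.altsum_vanishes p (N + n - 1)"
    unfolding M_def by (rule altsum_vanishes_DirProd_integer_mod_group[OF p(1) n N])
  \<comment> \<open>Fresh positions for the \<open>q\<close> appended copies of the neutral
    element.\<close>
  have "infinite (UNIV - I)" using I(1) by simp
  then obtain J where J: "J \<subseteq> UNIV - I" "finite J" "card J = q"
    using infinite_arbitrarily_large by blast
  define b where "b = (\<one>, 1 mod int n)"
  have b: "b \<in> carrier M" using n0 by (simp add: b_def M_def mod_in_carrier_integer_mod_group)
  define s' where "s' i = (if i \<in> I then (s i, 1 mod int n) else b)" for i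
  define f where "f y = (if y = (\<one>, int 0) then 1 else 0 :: int)" for y :: "'a \<times> int"
  have s'M: "s' \<in> I \<union> J \<rightarrow> carrier M"
    using s n0 b by (auto simp: s'_def M_def mod_in_carrier_integer_mod_group)
  have bq: "b [^]\<^bsub>M\<^esub> q = (\<one>, int q)"
  proof -
    have "b [^]\<^bsub>M\<^esub> q = (\<one>, int q * (1 mod int n) mod int n)"
      unfolding M_def b_def using n0
      by (subst pow_DirProd) (auto simp: comm_group_axioms mod_in_carrier_integer_mod_group)
    then show ?thesis using q by (simp add: mod_mult_right_eq)
  qed
  have oneM: "(\<one>, int 0) = \<one>\<^bsub>M\<^esub>" by (simp add: M_def)
  have "card (I \<union> J) = card I + q"
    using I J by (subst card_Un_disjoint) auto
  then have "[M.altsum s' (I \<union> J) f (\<one>, int 0) = 0] (mod int p)"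
    unfolding oneM using van I J s'M unfolding M.altsum_vanishes_def by simp
  also have "M.altsum s' (I \<union> J) f (\<one>, int 0) = M.altsum s' J (M.altsum s' I f) (\<one>, int 0)"
    unfolding oneM using I J s'M by (intro M.altsum_Un) auto
  finally have "[0 = M.altsum s' J (M.altsum s' I f) (\<one>, int 0)] (mod int p)" by (rule cong_sym)
  \<comment> \<open>The \<open>q\<close> factors \<open>1 - b\<close> multiply to
    \<open>1 - b ^ q\<close>, the sign being minus as \<open>p\<close> is odd. Translation by
    \<open>b ^ q\<close> starts the length count at \<open>q\<close>, which turns residue 0 into
    \<open>n - q\<close>.\<close>
  also have "[M.altsum s' J (M.altsum s' I f) (\<one>, int 0)
      = M.altsum s' I f (\<one>, int 0) + (-1) ^ (p ^ k)
          * M.altsum s' I f ((\<one>, int 0) \<otimes>\<^bsub>M\<^esub> b [^]\<^bsub>M\<^esub> (p ^ k))] (mod int p)"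
    unfolding oneM using J q b by (intro M.altsum_const_prime_power p) (auto simp: s'_def)
  also have "(\<one>, int 0) \<otimes>\<^bsub>M\<^esub> b [^]\<^bsub>M\<^esub> (p ^ k) = (\<one>, int q)"
    using bq q by (simp add: M_def)
  also have "(-1 :: int) ^ (p ^ k) = -1" using p(2) by simp
  also have "M.altsum s' I f (\<one>, int 0) = signed_count s I n 0"
    unfolding M_def f_def using n0 s I
    by (intro altsum_DirProd_integer_mod_group) (auto simp: s'_def)
  also have "M.altsum s' I f (\<one>, int q) = signed_count s I n (n - q)"
    unfolding M_def f_def
  proof (intro altsum_DirProd_integer_mod_group)
    fix m :: nat
    show "(q + m) mod n = 0 \<longleftrightarrow> m mod n = n - q"
    proof -
      have "m mod n < n" using n0 by simp
      then have "q + m mod n < 2 * n" using q(2) by linarith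
      have "(q + m) mod n = (q + m mod n) mod n" by (simp add: mod_add_right_eq)
      also have "\<dots> = (if q + m mod n < n then q + m mod n else q + m mod n - n)"
        using \<open>q + m mod n < 2 * n\<close> by (simp add: le_mod_geq)
      finally show ?thesis using q0 q \<open>m mod n < n\<close> by auto
    qed
  qed (use n0 s I q in \<open>auto simp: s'_def\<close>)
  finally have "[signed_count s I n 0 - signed_count s I n (n - q) = 0] (mod int p)"
    by (subst cong_sym_eq) simp
  then show ?thesis by (simp add: cong_diff_iff_cong_0)
qed

lemma finite_zero_sum_subsets [simp]: "finite I \<Longrightarrow> finite (zero_sum_subsets s I m)"
  by (rule finite_subset[of _ "Pow I"]) (auto simp: zero_sum_subsets_def)

lemma zero_sum_subsets_empty:
  "finite I \<Longrightarrow> card I < m \<Longrightarrow> zero_sum_subsets s I m = {}"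
  by (auto simp: zero_sum_subsets_def dest: card_mono)

lemma card_zero_sum_subsets_0:
  assumes "finite I"
  shows "card (zero_sum_subsets s I 0) = 1"
proof -
  have "zero_sum_subsets s I 0 = {{}}"
    using assms by (auto simp: zero_sum_subsets_def dest: finite_subset)
  then show ?thesis by simp
qed

text \<open>Sorts the subsets by size: the sizes below \<open>L * n\<close> in the residue class of
  \<open>r\<close> are \<open>r + j * n\<close> with \<open>j < L\<close>.\<close>

lemma signed_count_eq:
  assumes I: "finite I" "card I < L * n" and r: "r < n"
  shows "signed_count s I n r
    = (\<Sum>j<L. (-1) ^ (r + j * n) * int (card (zero_sum_subsets s I (r + j * n))))"
proof -
  define g where "g m = (-1) ^ m * int (card (zero_sum_subsets s I m))" for m
  have "signed_count s I n r = (\<Sum>m<L * n. \<Sum>T | T \<in> Pow I \<and> card T = m.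
      if finprod G s T = \<one> \<and> card T mod n = r then (-1) ^ card T else 0)"
    unfolding signed_count_def using I
    by (intro sum.group[symmetric]) (auto dest: card_mono[OF I(1)])
  also have "\<dots> = (\<Sum>m<L * n. if m mod n = r then g m else 0)"
  proof (rule sum.cong[OF refl])
    fix m
    have "(\<Sum>T | T \<in> Pow I \<and> card T = m. if finprod G s T = \<one> \<and> card T mod n = r then (-1) ^ card T else 0)
       = (\<Sum>T | T \<in> Pow I \<and> card T = m. if finprod G s T = \<one> then if m mod n = r then (-1) ^ m else 0 else 0)"
      by (rule sum.cong) auto
    also have "\<dots> = (\<Sum>T\<in>zero_sum_subsets s I m. if m mod n = r then (-1) ^ m else 0)"
      using I by (intro sum.mono_neutral_cong_right) (auto simp: zero_sum_subsets_def)
    also have "\<dots> = (if m mod n = r then g m else 0)"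
      by (simp add: g_def)
    finally show "(\<Sum>T | T \<in> Pow I \<and> card T = m. if finprod G s T = \<one> \<and> card T mod n = r then (-1) ^ card T else 0)
      = (if m mod n = r then g m else 0)" .
  qed
  also have "\<dots> = (\<Sum>m\<in>(\<lambda>j. r + j * n) ` {..<L}. g m)"
  proof (rule sum.mono_neutral_cong_right)
    show "(\<lambda>j. r + j * n) ` {..<L} \<subseteq> {..<L * n}"
    proof clarsimp
      fix j assume "j < L"
      then have "(j + 1) * n \<le> L * n" by (intro mult_right_mono) auto
      then show "r + j * n < L * n" using r by simp
    qed
    show "\<forall>m\<in>{..<L * n} - (\<lambda>j. r + j * n) ` {..<L}. (if m mod n = r then g m else 0) = 0"
    proof (intro ballI)
      fix m assume m: "m \<in> {..<L * n} - (\<lambda>j. r + j * n) ` {..<L}"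
      then have "m div n < L" by (simp add: less_mult_imp_div_less)
      moreover have "m = m mod n + m div n * n" by simp
      ultimately have "m mod n \<noteq> r" using m by blast
      then show "(if m mod n = r then g m else 0) = 0" by simp
    qed
  qed (use r in auto)
  also have "\<dots> = (\<Sum>j<L. g (r + j * n))"
    using r by (subst sum.reindex) (auto simp: inj_on_def)
  finally show ?thesis by (simp add: g_def)
qed

end

section \<open>Zero-sum subsets of length \<open>exp(H)\<close>\<close>

text \<open>In Vandermonde's identity \<open>p\<close> divides \<open>n choose i\<close> for
  \<open>0 < i < n\<close>; the end terms give \<open>m choose n\<close> and 1.\<close>

lemma choose_add_prime_power_cong:
  assumes p: "Factorial_Ring.prime (p :: nat)" and n: "n = p ^ e"
  shows "[int (m + n choose n) = int (m choose n) + 1] (mod int p)"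
proof -
  have n0: "n > 0" using n p by (simp add: prime_gt_0_nat)
  have "m + n choose n = (\<Sum>i\<le>n. (n choose i) * (m choose (n - i)))"
    using vandermonde[of n m n] by (simp add: add.commute)
  also have "\<dots> = (m choose n) + 1 + (\<Sum>i\<in>{..n} - {0, n}. (n choose i) * (m choose (n - i)))"
    using n0 by (subst sum.subset_diff[of "{0,n}"]) auto
  finally have eq: "int (m + n choose n)
    = int (m choose n) + 1 + int (\<Sum>i\<in>{..n} - {0, n}. (n choose i) * (m choose (n - i)))" by simp
  have "p dvd (\<Sum>i\<in>{..n} - {0, n}. (n choose i) * (m choose (n - i)))"
  proof (rule dvd_sum)
    fix i assume "i \<in> {..n} - {0, n}"
    then show "p dvd (n choose i) * (m choose (n - i))"
      using prime_dvd_choose_prime_power[OF p, of i e] n by auto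
  qed
  then have "[int (m + n choose n) = int (m choose n) + 1 + 0] (mod int p)"
    unfolding eq by (intro cong_add cong_refl) (simp only: cong_0_iff int_dvd_int_iff)
  then show ?thesis by simp
qed

context comm_group
begin

section \<open>Double counting of zero-sum subsets\<close>

lemma finprod_Diff_eq_one:
  assumes "finite T" "U \<subseteq> T" "s \<in> T \<rightarrow> carrier G" "finprod G s T = \<one>" "finprod G s U = \<one>"
  shows "finprod G s (T - U) = \<one>"
proof -
  have "finprod G s (U \<union> (T - U)) = finprod G s U \<otimes> finprod G s (T - U)"
    using assms finite_subset by (intro finprod_Un_disjoint) auto
  moreover have "U \<union> (T - U) = T" using assms(2) by auto
  moreover have "finprod G s (T - U) \<in> carrier G" using assms by (intro finprod_closed) auto
  ultimately show ?thesis using assms by simp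
qed

lemma finprod_Un_eq_one:
  assumes "finite T" "finite U" "T \<inter> U = {}" "s \<in> T \<union> U \<rightarrow> carrier G"
    "finprod G s T = \<one>" "finprod G s U = \<one>"
  shows "finprod G s (T \<union> U) = \<one>"
  using assms by (subst finprod_Un_disjoint) auto

text \<open>Double counting of pairs \<open>T \<subseteq> J\<close>: given \<open>T\<close>, the
  complement of \<open>J\<close> is an arbitrary set of \<open>c\<close> elements of
  \<open>I - T\<close>.\<close>

lemma sum_card_zero_sum_subsets:
  assumes I: "finite I" and c: "c \<le> card I" and t: "t \<le> card I"
  shows "(\<Sum>J | J \<subseteq> I \<and> card J = card I - c. card (zero_sum_subsets s J t))
    = (card I - t choose c) * card (zero_sum_subsets s I t)"
proof -
  define \<J> where "\<J> = {J. J \<subseteq> I \<and> card J = card I - c}"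
  have fJ: "finite \<J>" unfolding \<J>_def using I by simp
  have "(\<Sum>J\<in>\<J>. card (zero_sum_subsets s J t))
      = (\<Sum>J\<in>\<J>. card {T \<in> zero_sum_subsets s I t. T \<subseteq> J})"
    by (intro sum.cong refl arg_cong[of _ _ card]) (auto simp: \<J>_def zero_sum_subsets_def)
  also have "\<dots> = (card I - t choose c) * card (zero_sum_subsets s I t)"
  proof (rule sum_multicount[OF fJ], use I in simp, rule ballI)
    fix T assume T: "T \<in> zero_sum_subsets s I t"
    then have T': "T \<subseteq> I" "card T = t" "finite T"
      using I finite_subset by (auto simp: zero_sum_subsets_def)
    have "bij_betw (\<lambda>J. I - J) {J \<in> \<J>. T \<subseteq> J} {C. C \<subseteq> I - T \<and> card C = c}"
    proof (rule bij_betw_byWitness[where f' = "\<lambda>C. I - C"])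
      show "(\<lambda>J. I - J) ` {J \<in> \<J>. T \<subseteq> J} \<subseteq> {C. C \<subseteq> I - T \<and> card C = c}"
        using I c by (auto simp: \<J>_def card_Diff_subset finite_subset)
      show "(\<lambda>C. I - C) ` {C. C \<subseteq> I - T \<and> card C = c} \<subseteq> {J \<in> \<J>. T \<subseteq> J}"
      proof clarsimp
        fix C assume C: "C \<subseteq> I - T" "c = card C"
        then have "card (I - C) = card I - card C"
          using I finite_subset by (intro card_Diff_subset) auto
        then show "I - C \<in> \<J> \<and> T \<subseteq> I - C" using C T' by (auto simp: \<J>_def)
      qed
    qed (auto simp: \<J>_def)
    then have "card {J \<in> \<J>. T \<subseteq> J} = card {C. C \<subseteq> I - T \<and> card C = c}"
      by (rule bij_betw_same_card)
    also have "\<dots> = card (I - T) choose c" using I by (simp add: n_subsets)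
    also have "card (I - T) = card I - t" using T' I by (simp add: card_Diff_subset)
    finally show "card {J \<in> \<J>. T \<subseteq> J} = card I - t choose c" .
  qed
  finally show ?thesis by (simp add: \<J>_def)
qed

text \<open>Disjoint zero-sum sets \<open>A\<close> and \<open>C\<close> correspond to the zero-sum
  set \<open>W = A \<union> C\<close> with its zero-sum subset \<open>C\<close>, since
  \<open>W - C\<close> again has trivial product.\<close>

lemma sum_zero_sum_pairs:
  assumes I: "finite I" and s: "s \<in> I \<rightarrow> carrier G"
  shows "(\<Sum>A\<in>zero_sum_subsets s I a. card (zero_sum_subsets s (I - A) c))
    = (\<Sum>W\<in>zero_sum_subsets s I (a + c). card (zero_sum_subsets s W c))"
proof -
  let ?P = "Sigma (zero_sum_subsets s I a) (\<lambda>A. zero_sum_subsets s (I - A) c)"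
  let ?Q = "Sigma (zero_sum_subsets s I (a + c)) (\<lambda>W. zero_sum_subsets s W c)"
  have fin: "finite T" if "T \<subseteq> I" for T using that I finite_subset by blast
  have "bij_betw (\<lambda>(A, C). (A \<union> C, C)) ?P ?Q"
  proof (rule bij_betw_byWitness[where f' = "\<lambda>(W, C). (W - C, C)"])
    show "(\<lambda>(A, C). (A \<union> C, C)) ` ?P \<subseteq> ?Q"
    proof clarsimp
      fix A C assume "A \<in> zero_sum_subsets s I a" "C \<in> zero_sum_subsets s (I - A) c"
      then have *: "A \<subseteq> I" "card A = a" "finprod G s A = \<one>" "C \<subseteq> I - A" "card C = c" "finprod G s C = \<one>"
        by (auto simp: zero_sum_subsets_def)
      have "finite A" "finite C" using * by (auto intro: fin)
      moreover have "A \<inter> C = {}" using * by auto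
      moreover have "s \<in> A \<union> C \<rightarrow> carrier G" using * s by auto
      ultimately have "finprod G s (A \<union> C) = \<one>" "card (A \<union> C) = a + c"
        using * by (auto intro: finprod_Un_eq_one simp: card_Un_disjoint)
      then show "A \<union> C \<in> zero_sum_subsets s I (a + c) \<and> C \<in> zero_sum_subsets s (A \<union> C) c"
        using * by (auto simp: zero_sum_subsets_def)
    qed
    show "(\<lambda>(W, C). (W - C, C)) ` ?Q \<subseteq> ?P"
    proof clarsimp
      fix W C assume "W \<in> zero_sum_subsets s I (a + c)" "C \<in> zero_sum_subsets s W c"
      then have *: "W \<subseteq> I" "card W = a + c" "finprod G s W = \<one>" "C \<subseteq> W" "card C = c" "finprod G s C = \<one>"
        by (auto simp: zero_sum_subsets_def)
      have "finite W" "finite C" using * by (auto intro: fin)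
      moreover have "s \<in> W \<rightarrow> carrier G" using * s by auto
      ultimately have "finprod G s (W - C) = \<one>" "card (W - C) = a"
        using * by (auto intro: finprod_Diff_eq_one simp: card_Diff_subset)
      then show "W - C \<in> zero_sum_subsets s I a \<and> C \<in> zero_sum_subsets s (I - (W - C)) c"
        using * by (auto simp: zero_sum_subsets_def)
    qed
  qed (auto simp: zero_sum_subsets_def)
  then have "card ?P = card ?Q" by (rule bij_betw_same_card)
  moreover have "card ?P = (\<Sum>A\<in>zero_sum_subsets s I a. card (zero_sum_subsets s (I - A) c))"
    using I by (intro card_SigmaI) auto
  moreover have "card ?Q = (\<Sum>W\<in>zero_sum_subsets s I (a + c). card (zero_sum_subsets s W c))"
    using I fin by (intro card_SigmaI) (auto simp: zero_sum_subsets_def)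
  ultimately show ?thesis by simp
qed

text \<open>Below \<open>2 * n\<close> the only multiples of \<open>n\<close> are 0 and
  \<open>n\<close>. Without zero-sum subsets of length \<open>n\<close> the signed count is 1, from
  the empty set, although it must vanish modulo \<open>p\<close>.\<close>

theorem zero_sum_subset_of_prime_power_length:
  assumes p: "Factorial_Ring.prime (p :: nat)" and n: "n = p ^ e"
    and N: "altsum_vanishes p N" and I: "finite (I :: nat set)" and s: "s \<in> I \<rightarrow> carrier G"
    and cardI: "N + n - 1 \<le> card I" "card I < 2 * n"
  shows "zero_sum_subsets s I n \<noteq> {}"
proof
  assume *: "zero_sum_subsets s I n = {}"
  have n0: "n > 0" using n p by (simp add: prime_gt_0_nat)
  have "signed_count s I n 0
      = (\<Sum>j<2. (-1) ^ (0 + j * n) * int (card (zero_sum_subsets s I (0 + j * n))))"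
    using cardI n0 I by (intro signed_count_eq) auto
  also have "\<dots> = 1"
    using * I by (simp add: lessThan_nat_numeral card_zero_sum_subsets_0)
  finally have "[1 = 0] (mod int p)"
    using signed_count_0[OF p n N I cardI(1) s] by simp
  then show False using prime_gt_1_nat[OF p] by (simp add: cong_def)
qed

text \<open>For \<open>N \<le> n\<close> the preceding theorem applies to a smaller index set.
  Otherwise, if length \<open>n\<close> does not occur, congruences between the numbers
  \<open>c J t\<close> of zero-sum subsets combine to 2 being 0 modulo the odd prime
  \<open>p\<close>.\<close>

theorem zero_sum_subset_exists:
  assumes p: "Factorial_Ring.prime (p :: nat)" "odd p" and n: "n = p ^ e" and q: "q = p ^ k" "q \<le> n"
    and N: "altsum_vanishes p N" "N + q \<le> 2 * n"
    and Y: "finite (Y :: nat set)" "N + 2 * n \<le> card Y + q + 1" and sY: "s \<in> Y \<rightarrow> carrier G"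
  shows "zero_sum_subsets s Y n \<noteq> {}"
proof (cases "N \<le> n")
  case True
  have n0: "n > 0" using n p by (simp add: prime_gt_0_nat)
  have "N + n - 1 \<le> card Y" using Y q(2) by linarith
  then obtain I where I: "I \<subseteq> Y" "card I = N + n - 1" "finite I"
    using obtain_subset_with_card_n by blast
  have "zero_sum_subsets s I n \<noteq> {}"
    using True I sY n0 by (intro zero_sum_subset_of_prime_power_length[OF p(1) n N(1)]) auto
  moreover have "zero_sum_subsets s I n \<subseteq> zero_sum_subsets s Y n"
    using I by (auto simp: zero_sum_subsets_def)
  ultimately show ?thesis by blast
next
  case False
  have n0: "n > 0" using n p by (simp add: prime_gt_0_nat)
  have q0: "q > 0" using q p by (simp add: prime_gt_0_nat)
  have qn: "q < n" "q < N" using False N(2) by linarith+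
  have odd_n: "odd n" "odd q" using n q p by auto
  have "N + 2 * n - q - 1 \<le> card Y" using Y by linarith
  \<comment> \<open>This size is chosen such that removing \<open>n - q\<close> elements leaves
    \<open>N + n - 1\<close>, enough for \<open>signed_count_0\<close>, and removing
    \<open>n\<close> leaves \<open>N + n - 1 - q\<close>, enough for
    \<open>signed_count_shift\<close>.\<close>
  then obtain I where I: "I \<subseteq> Y" "card I = N + 2 * n - q - 1" "finite I"
    using obtain_subset_with_card_n by blast
  have s: "s \<in> I \<rightarrow> carrier G" using I sY by auto
  define c where "c J t = int (card (zero_sum_subsets s J t))" for J t
  have c0: "c J t = 0" if "finite J" "card J < t" for J t
    using zero_sum_subsets_empty[OF that] by (simp add: c_def)
  have c_zero: "c J 0 = 1" if "finite J" for J
    using card_zero_sum_subsets_0[OF that] by (simp add: c_def)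
  have "zero_sum_subsets s I n \<noteq> {}"
  proof
    assume *: "zero_sum_subsets s I n = {}"
    have cn: "c J n = 0" if "J \<subseteq> I" for J
    proof -
      have "zero_sum_subsets s J n \<subseteq> zero_sum_subsets s I n"
        using that by (auto simp: zero_sum_subsets_def)
      then show ?thesis using * by (simp add: c_def)
    qed
    \<comment> \<open>Less than \<open>4 * n\<close> elements leave the lengths 0, \<open>n\<close>,
      \<open>2 * n\<close>, \<open>3 * n\<close>, with alternating signs as \<open>n\<close> is odd;
      length \<open>n\<close> is excluded by assumption.\<close>
    have count0: "signed_count s J n 0 = 1 + c J (2 * n) - c J (3 * n)"
      if "J \<subseteq> I" for J
    proof -
      have "finite J" "card J \<le> card I"
        using finite_subset[OF that I(3)] card_mono[OF I(3) that] by auto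
      moreover have "card I < 4 * n" using I N(2) n0 q0 by linarith
      ultimately have "signed_count s J n 0
          = (\<Sum>j<4. (-1) ^ (0 + j * n) * int (card (zero_sum_subsets s J (0 + j * n))))"
        using n0 by (intro signed_count_eq) auto
      then show ?thesis
        using odd_n cn[OF that] c_zero[OF \<open>finite J\<close>]
        by (simp add: lessThan_nat_numeral c_def)
    qed
    \<comment> \<open>The signs start with plus because \<open>n - q\<close> is even; the length
      \<open>4 * n - q\<close> exceeds \<open>card I\<close>.\<close>
    have countq: "signed_count s J n (n - q) = c J (n - q) - c J (2 * n - q) + c J (3 * n - q)"
      if "J \<subseteq> I" for J
    proof -
      have J: "finite J" "card J \<le> card I"
        using finite_subset[OF that I(3)] card_mono[OF I(3) that] by auto
      have cI: "card I < 4 * n" "card I < 4 * n - q" using I N(2) n0 q0 by linarith+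
      then have "signed_count s J n (n - q)
          = (\<Sum>j<4. (-1) ^ (n - q + j * n) * int (card (zero_sum_subsets s J (n - q + j * n))))"
        using n0 q0 J by (intro signed_count_eq) auto
      moreover have "c J (4 * n - q) = 0" using J cI by (intro c0) auto
      moreover have "n - q + n = 2 * n - q" "n - q + 2 * n = 3 * n - q" "n - q + 3 * n = 4 * n - q"
        using qn by auto
      moreover have "even (n - q)" using odd_n by simp
      ultimately show ?thesis
        using odd_n by (simp add: lessThan_nat_numeral c_def power_add)
    qed
    have c2n: "[c J (2 * n) = - 1] (mod int p)"
      if "J \<subseteq> I" "N + n - 1 \<le> card J" "card J < 3 * n" for J
    proof -
      have J: "finite J" "s \<in> J \<rightarrow> carrier G" using that I s finite_subset by auto
      have "[signed_count s J n 0 = 0] (mod int p)"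
        by (rule signed_count_0[OF p(1) n N(1) J(1) that(2) J(2)])
      also have "signed_count s J n 0 = c J (2 * n) - (- 1)"
        using count0[OF that(1)] c0[OF J(1) that(3)] by simp
      finally show ?thesis by (simp only: cong_diff_iff_cong_0)
    qed
    have p1: "\<not> [0 = - 1] (mod int p)" "\<not> [2 = 0] (mod int p)"
    proof -
      have "p \<noteq> 2" using p(2) by auto
      then have "p > 2" using prime_gt_1_nat[OF p(1)] by linarith
      then show "\<not> [0 = - 1] (mod int p)" "\<not> [2 = 0] (mod int p)"
        by (auto simp: cong_iff_dvd_diff zdvd_not_zless)
    qed
    \<comment> \<open>After dropping one element of a zero-sum set \<open>T\<close> of size
      \<open>3 * n\<close>, \<open>c2n\<close> still yields a zero-sum set \<open>U\<close> of size
      \<open>2 * n\<close> in it; then \<open>T - U\<close> would have the excluded size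
      \<open>n\<close>.\<close>
    have c3n: "c I (3 * n) = 0"
    proof -
      have False if "T \<in> zero_sum_subsets s I (3 * n)" for T
      proof -
        have T: "T \<subseteq> I" "card T = 3 * n" "finprod G s T = \<one>" "finite T"
          using that I finite_subset by (auto simp: zero_sum_subsets_def)
        then obtain t where t: "t \<in> T" using n0 by fastforce
        have "card (T - {t}) = 3 * n - 1" using T t by simp
        then have "[c (T - {t}) (2 * n) = - 1] (mod int p)"
          using T n0 q0 N(2) by (intro c2n) auto
        then have "c (T - {t}) (2 * n) \<noteq> 0" using p1 by metis
        then have "zero_sum_subsets s (T - {t}) (2 * n) \<noteq> {}" by (auto simp: c_def)
        then obtain U where "U \<in> zero_sum_subsets s (T - {t}) (2 * n)" by blast
        then have U: "U \<subseteq> T" "card U = 2 * n" "finprod G s U = \<one>"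
          by (auto simp: zero_sum_subsets_def)
        have "finprod G s (T - U) = \<one>"
          using T U s by (intro finprod_Diff_eq_one) auto
        moreover have "card (T - U) = n"
          using T U finite_subset by (subst card_Diff_subset) auto
        ultimately have "T - U \<in> zero_sum_subsets s I n"
          using T by (auto simp: zero_sum_subsets_def)
        then show False using * by simp
      qed
      then have "zero_sum_subsets s I (3 * n) = {}" by blast
      then show ?thesis by (simp add: c_def)
    qed
    have "N + n - 1 \<le> card I" using I qn by linarith
    then have I0: "[signed_count s I n 0 = 0] (mod int p)"
      by (rule signed_count_0[OF p(1) n N(1) I(3) _ s])
    then have "[c I (2 * n) - (- 1) = 0] (mod int p)"
      using count0[of I] c3n by (simp add: add.commute)
    then have c2nI: "[c I (2 * n) = - 1] (mod int p)" by (simp only: cong_diff_iff_cong_0)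
    have shift: "[signed_count s J n 0 = signed_count s J n (n - q)] (mod int p)"
      if "J \<subseteq> I" "N + n - 1 \<le> card J + q" for J
      using that I s finite_subset
      by (intro signed_count_shift[OF p n q(1) qn(1) N(1)]) auto
    \<comment> \<open>Count the pairs of disjoint zero-sum subsets of lengths \<open>n - q\<close> and \<open>2n\<close> in two ways.\<close>
    have pairs: "[c I (n - q) = c I (3 * n - q)] (mod int p)"
    proof -
      \<comment> \<open>Both ways of counting have inner counts congruent to -1 by
        \<open>c2n\<close>: \<open>I - A\<close> has size \<open>N + n - 1\<close> and
        \<open>W\<close> has size \<open>3 * n - q\<close>, both within its range.\<close>
      have sumA: "[(\<Sum>A\<in>zero_sum_subsets s I (n - q). c (I - A) (2 * n))
          = (\<Sum>A\<in>zero_sum_subsets s I (n - q). - 1)] (mod int p)"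
      proof (intro cong_sum c2n)
        fix A assume "A \<in> zero_sum_subsets s I (n - q)"
        then have A: "A \<subseteq> I" "card A = n - q" by (auto simp: zero_sum_subsets_def)
        then have "card (I - A) = card I - (n - q)"
          using I finite_subset by (subst card_Diff_subset) auto
        then show "N + n - 1 \<le> card (I - A)" "card (I - A) < 3 * n"
          using I(2) qn q0 N(2) by linarith+
      qed auto
      have "(\<Sum>A\<in>zero_sum_subsets s I (n - q). c (I - A) (2 * n))
          = (\<Sum>W\<in>zero_sum_subsets s I (3 * n - q). c W (2 * n))"
      proof -
        have "n - q + 2 * n = 3 * n - q" using qn by simp
        then show ?thesis
          using sum_zero_sum_pairs[OF I(3) s, where a = "n - q" and c = "2 * n"]
          by (simp only: c_def flip: of_nat_sum)
      qed
      also have "[\<dots>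
          = (\<Sum>W\<in>zero_sum_subsets s I (3 * n - q). - 1)] (mod int p)"
      proof (intro cong_sum c2n)
        fix W assume "W \<in> zero_sum_subsets s I (3 * n - q)"
        then have "W \<subseteq> I" "card W = 3 * n - q" by (auto simp: zero_sum_subsets_def)
        then show "W \<subseteq> I" "N + n - 1 \<le> card W" "card W < 3 * n"
          using qn q0 N(2) by linarith+
      qed
      finally have "[(\<Sum>A\<in>zero_sum_subsets s I (n - q). - 1)
          = (\<Sum>W\<in>zero_sum_subsets s I (3 * n - q). - 1)] (mod int p)"
        by (rule cong_trans[OF cong_sym[OF sumA]])
      then show ?thesis by (simp add: c_def cong_minus_minus_iff)
    qed
    have "[signed_count s I n (n - q) = 0] (mod int p)"
    proof (rule cong_trans[OF cong_sym I0])
      show "[signed_count s I n 0 = signed_count s I n (n - q)] (mod int p)"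
        using \<open>N + n - 1 \<le> card I\<close> by (intro shift) auto
    qed
    then have E: "[c I (n - q) - c I (2 * n - q) + c I (3 * n - q) = 0] (mod int p)"
      using countq[of I] by simp
    \<comment> \<open>Sum the relation \<open>shift\<close> over all subsets \<open>J\<close> of the least size for which it holds.\<close>
    define \<J> where "\<J> = {J. J \<subseteq> I \<and> card J = card I - n}"
    have nI: "n \<le> card I" using I qn by linarith
    have sumJ: "(\<Sum>J\<in>\<J>. c J t) = int (card I - t choose n) * c I t" if "t \<le> card I" for t
      using sum_card_zero_sum_subsets[OF I(3) nI that, of s]
      by (simp add: \<J>_def c_def flip: of_nat_sum of_nat_mult)
    have "[(\<Sum>J\<in>\<J>. c J 0 + c J (2 * n)) = (\<Sum>J\<in>\<J>. c J (n - q) - c J (2 * n - q))] (mod int p)"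
    proof (rule cong_sum)
      fix J assume "J \<in> \<J>"
      then have J: "J \<subseteq> I" "card J = N + n - q - 1" "finite J"
        using I finite_subset by (auto simp: \<J>_def)
      have "[signed_count s J n 0 = signed_count s J n (n - q)] (mod int p)"
        using J qn by (intro shift) auto
      \<comment> \<open>The sets \<open>J\<close> have \<open>N + n - q - 1\<close> elements, fewer
        than \<open>3 * n - q\<close> because \<open>N + q \<le> 2 * n\<close>.\<close>
      moreover have "c J (3 * n) = 0" "c J (3 * n - q) = 0"
        using J N(2) q0 qn by (auto intro!: c0)
      ultimately show "[c J 0 + c J (2 * n) = c J (n - q) - c J (2 * n - q)] (mod int p)"
        using count0[OF J(1)] countq[OF J(1)] c_zero[OF J(3)] by simp
    qed
    also have "(\<Sum>J\<in>\<J>. c J (n - q) - c J (2 * n - q)) = int (N + n - 1 choose n) * c I (n - q)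
        - int (N - 1 choose n) * c I (2 * n - q)"
    proof -
      have "card I - (n - q) = N + n - 1" "card I - (2 * n - q) = N - 1"
        "n - q \<le> card I" "2 * n - q \<le> card I"
        using I qn by linarith+
      then show ?thesis by (simp add: sum_subtractf sumJ)
    qed
    also have "(\<Sum>J\<in>\<J>. c J 0 + c J (2 * n))
        = int (card I choose n) + int (N - q - 1 choose n) * c I (2 * n)"
    proof -
      have "card I - 2 * n = N - q - 1" "2 * n \<le> card I" using I qn by linarith+
      then show ?thesis by (simp add: sum.distrib sumJ c_zero[OF I(3)])
    qed
    finally have main: "[int (card I choose n) + int (N - q - 1 choose n) * c I (2 * n)
        = int (N + n - 1 choose n) * c I (n - q) - int (N - 1 choose n) * c I (2 * n - q)] (mod int p)" .
    \<comment> \<open>Kept unevaluated: it cancels at the end.\<close>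
    define u where "u = int (N - q - 1 choose n)"
    have b1: "[int (card I choose n) = u + 2] (mod int p)"
    proof -
      have "card I = (N - q - 1 + n) + n" using I qn by linarith
      then have "[int (card I choose n) = int (N - q - 1 + n choose n) + 1] (mod int p)"
        using choose_add_prime_power_cong[OF p(1) n] by simp
      also have "[int (N - q - 1 + n choose n) + 1 = u + 1 + 1] (mod int p)"
        unfolding u_def by (intro cong_add cong_refl choose_add_prime_power_cong[OF p(1) n])
      finally show ?thesis by (simp add: add.commute)
    qed
    \<comment> \<open>Here \<open>n \<le> N - 1 < 2 * n\<close>, so \<open>N - 1 = m + n\<close>
      with \<open>m < n\<close> and \<open>m choose n\<close> is 0.\<close>
    have b2: "[int (N - 1 choose n) = 1] (mod int p)"
    proof -
      obtain m where m: "N = n + 1 + m" using False by (metis Suc_eq_plus1 less_iff_Suc_add not_le add_Suc)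
      then have "N - 1 = m + n" "m < n" using N(2) q0 by linarith+
      then show ?thesis
        using choose_add_prime_power_cong[OF p(1) n, of m] by (simp add: binomial_eq_0)
    qed
    have b3: "[int (N + n - 1 choose n) = 2] (mod int p)"
    proof -
      have "N + n - 1 = N - 1 + n" using qn by linarith
      then have "[int (N + n - 1 choose n) = int (N - 1 choose n) + 1] (mod int p)"
        using choose_add_prime_power_cong[OF p(1) n, of "N - 1"] by (simp only:)
      also have "[int (N - 1 choose n) + 1 = 1 + 1] (mod int p)"
        by (intro cong_add cong_refl b2)
      finally show ?thesis by simp
    qed
    \<comment> \<open>As \<open>c I (2 * n)\<close> is -1 modulo \<open>p\<close>, \<open>u\<close>
      cancels on the left of \<open>main\<close>. On the right, \<open>pairs\<close> replaces one of
      the two copies of \<open>c I (n - q)\<close> by \<open>c I (3 * n - q)\<close>, and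
      \<open>E\<close> makes the result 0.\<close>
    have "[2 = u + 2 + u * (- 1)] (mod int p)" by simp
    also have "[u + 2 + u * (- 1) = int (card I choose n) + u * c I (2 * n)] (mod int p)"
      by (intro cong_add cong_mult cong_refl cong_sym[OF b1] cong_sym[OF c2nI])
    also have "[int (card I choose n) + u * c I (2 * n)
        = int (N + n - 1 choose n) * c I (n - q) - int (N - 1 choose n) * c I (2 * n - q)] (mod int p)"
      using main by (simp add: u_def)
    also have "[int (N + n - 1 choose n) * c I (n - q) - int (N - 1 choose n) * c I (2 * n - q)
        = 2 * c I (n - q) - 1 * c I (2 * n - q)] (mod int p)"
      by (intro cong_diff cong_mult cong_refl b2 b3)
    also have "2 * c I (n - q) - 1 * c I (2 * n - q)
        = c I (n - q) - c I (2 * n - q) + c I (n - q)" by simp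
    also have "[\<dots> = c I (n - q) - c I (2 * n - q) + c I (3 * n - q)] (mod int p)"
      by (intro cong_add cong_refl pairs)
    also note E
    finally show False using p1 by simp
  qed
  moreover have "zero_sum_subsets s I n \<subseteq> zero_sum_subsets s Y n"
    using I by (auto simp: zero_sum_subsets_def)
  ultimately show ?thesis by blast
qed

end

section \<open>Passing to \<open>H \<oplus> C\<^sub>a\<close>\<close>

text \<open>Greedy extraction: before the last of \<open>t\<close> blocks is chosen,
  \<open>(t - 1) * n\<close> elements are used up and \<open>L\<close> must remain. The size bound
  states this without subtraction.\<close>

lemma disjoint_blocks_exist:
  assumes n: "n > 0" and Q: "\<And>I. \<lbrakk>I \<subseteq> Y; finite I; L \<le> card I\<rbrakk> \<Longrightarrow> \<exists>T\<subseteq>I. card T = n \<and> Q T"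
    and Y: "finite Y" "L + t * n \<le> card Y + n"
  shows "\<exists>F. (\<forall>j<t. F j \<subseteq> Y \<and> card (F j) = n \<and> Q (F j)) \<and> disjoint_family_on F {..<t}"
  using Y(2)
proof (induction t)
  case 0
  then show ?case by (simp add: disjoint_family_on_def)
next
  case (Suc t)
  then obtain F where F: "\<forall>j<t. F j \<subseteq> Y \<and> card (F j) = n \<and> Q (F j)" "disjoint_family_on F {..<t}"
    by auto
  define U where "U = (\<Union>j<t. F j)"
  have "U \<subseteq> Y" using F by (auto simp: U_def)
  have fF: "finite (F j)" if "j < t" for j using F that Y(1) finite_subset by blast
  have "card U = (\<Sum>j<t. card (F j))"
    unfolding U_def using F fF by (intro card_UN_disjoint) (auto simp: disjoint_family_on_def)
  also have "\<dots> = t * n" using F by simp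
  finally have "L \<le> card (Y - U)"
    using Suc.prems Y(1) \<open>U \<subseteq> Y\<close> finite_subset[OF \<open>U \<subseteq> Y\<close> Y(1)] by (simp add: card_Diff_subset)
  then obtain T where T: "T \<subseteq> Y - U" "card T = n" "Q T"
    using Q[of "Y - U"] Y(1) by auto
  define F' where "F' = F(t := T)"
  have "\<forall>j<Suc t. F' j \<subseteq> Y \<and> card (F' j) = n \<and> Q (F' j)"
    using F T by (auto simp: F'_def less_Suc_eq)
  moreover have "disjoint_family_on F' {..<Suc t}"
    unfolding disjoint_family_on_def
  proof (intro ballI impI)
    have T_disj: "F j \<inter> T = {}" if "j < t" for j
      using T that by (auto simp: U_def)
    fix i j assume "i \<in> {..<Suc t}" "j \<in> {..<Suc t}" "i \<noteq> j"
    then consider "i < t" "j < t" | "i = t" "j < t" | "i < t" "j = t" by fastforce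
    then show "F' i \<inter> F' j = {}"
    proof cases
      case 1
      then show ?thesis using F(2) \<open>i \<noteq> j\<close> by (auto simp: F'_def disjoint_family_on_def)
    next
      case 2
      then show ?thesis using T_disj[of j] by (auto simp: F'_def)
    next
      case 3
      then show ?thesis using T_disj[of i] by (auto simp: F'_def)
    qed
  qed
  ultimately show ?case by blast
qed

lemma card_UN_blocks:
  fixes t :: nat
  assumes "A \<subseteq> {..<t}" "\<And>j. j < t \<Longrightarrow> finite (F j) \<and> card (F j) = n" "disjoint_family_on F {..<t}"
  shows "card (\<Union>j\<in>A. F j) = card A * n"
proof -
  have "finite A" using assms(1) finite_subset by blast
  then have "card (\<Union>j\<in>A. F j) = (\<Sum>j\<in>A. card (F j))"
  proof (rule card_UN_disjoint)
    show "\<forall>j\<in>A. finite (F j)" using assms(1,2) by blast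
    show "\<forall>i\<in>A. \<forall>j\<in>A. i \<noteq> j \<longrightarrow> F i \<inter> F j = {}"
      using assms(1,3) unfolding disjoint_family_on_def by blast
  qed
  also have "\<dots> = (\<Sum>j\<in>A. n)" using assms(1,2) by (intro sum.cong) auto
  finally show ?thesis by simp
qed

section \<open>The Erdos-Ginzburg-Ziv theorem for cyclic groups\<close>

text \<open>The group \<open>C_p\<close> is generated by one element of order \<open>p\<close>, so
  vanishing holds for \<open>N = p\<close>; with \<open>n = p\<close> the bound
  \<open>N + n - 1\<close> is \<open>2 * p - 1\<close>, which is below \<open>2 * n\<close>.\<close>

lemma erdos_ginzburg_ziv_prime:
  assumes p: "Factorial_Ring.prime (p :: nat)" and I: "finite (I :: nat set)" "card I = 2 * p - 1"
  shows "\<exists>T\<subseteq>I. card T = p \<and> int p dvd (\<Sum>i\<in>T. z i)"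
proof -
  interpret Z: comm_group "integer_mod_group p" by simp
  have p1: "p > 1" using p by (rule prime_gt_1_nat)
  have one: "1 \<in> carrier (integer_mod_group p)" using p1 by (simp add: carrier_integer_mod_group)
  have gen: "generate (integer_mod_group p) {1} = carrier (integer_mod_group p)"
  proof
    show "generate (integer_mod_group p) {1} \<subseteq> carrier (integer_mod_group p)"
      using Z.generate_incl[of "{1}"] one by simp
    show "carrier (integer_mod_group p) \<subseteq> generate (integer_mod_group p) {1}"
    proof
      fix x assume "x \<in> carrier (integer_mod_group p)"
      then have "x = 1 [^]\<^bsub>integer_mod_group p\<^esub> x"
        using p1 by (simp add: int_pow_integer_mod_group carrier_integer_mod_group)
      also have "\<dots> \<in> generate (integer_mod_group p) {1}"
        using one by (intro Z.subgroup_int_pow_closed Z.generate_is_subgroup generate.incl) auto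
      finally show "x \<in> generate (integer_mod_group p) {1}" .
    qed
  qed
  have "Z.altsum_vanishes p (1 + (\<Sum>b\<in>{1 :: int}. p - 1))"
  proof (rule Z.altsum_vanishes_generators[OF p _ _ gen])
    show "0 < p \<and> b [^]\<^bsub>integer_mod_group p\<^esub> p = \<one>\<^bsub>integer_mod_group p\<^esub> \<and> (\<exists>j. p = p ^ j)"
      if "b \<in> {1}" for b
      using that p1 by (auto intro: exI[of _ 1])
  qed (use one in auto)
  then have N: "Z.altsum_vanishes p p" using p1 by simp
  define s where "s i = z i mod int p" for i
  have s: "s i \<in> carrier (integer_mod_group p)" for i
    using p1 by (simp add: s_def mod_in_carrier_integer_mod_group)
  have "Z.zero_sum_subsets s I p \<noteq> {}"
    using I p1 s by (intro Z.zero_sum_subset_of_prime_power_length[OF p _ N, of _ 1]) auto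
  then obtain T where T: "T \<subseteq> I" "card T = p" "finprod (integer_mod_group p) s T = 0"
    by (auto simp: Z.zero_sum_subsets_def)
  have "(\<Sum>i\<in>T. s i) mod int p = 0"
    using T(3) s p1 by (subst (asm) finprod_integer_mod_group) auto
  then have "int p dvd (\<Sum>i\<in>T. z i)"
    by (simp add: s_def mod_sum_eq dvd_eq_mod_eq_0)
  then show ?thesis using T by blast
qed

text \<open>Induction along \<open>a = p * c\<close>: extract \<open>2 * c - 1\<close> disjoint
  blocks of length \<open>p\<close> with sum divisible by \<open>p\<close>, then apply the statement
  for \<open>c\<close> to the block sums divided by \<open>p\<close>. The extraction needs
  \<open>2 * p - 1 + (2 * c - 2) * p = 2 * a - 1\<close> elements.\<close>

theorem erdos_ginzburg_ziv:
  fixes z :: "nat \<Rightarrow> int"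
  assumes "a > 0" "finite I" "2 * a - 1 \<le> card I"
  shows "\<exists>T\<subseteq>I. card T = a \<and> int a dvd (\<Sum>i\<in>T. z i)"
  using assms
proof (induction a arbitrary: I z rule: less_induct)
  case (less a)
  show ?case
  proof (cases "a = 1")
    case True
    then obtain T where "T \<subseteq> I" "card T = 1"
      using less.prems obtain_subset_with_card_n[of 1 I] by auto
    then show ?thesis using True by auto
  next
    case False
    then obtain p where p: "Factorial_Ring.prime p" "p dvd a" using prime_factor_nat by blast
    then obtain c where c: "a = p * c" by blast
    have p1: "p > 1" using p(1) by (rule prime_gt_1_nat)
    have c0: "c > 0" "c < a" using c less.prems(1) p1 by auto
    have "\<exists>F. (\<forall>j<2 * c - 1. F j \<subseteq> I \<and> card (F j) = p \<and> int p dvd (\<Sum>i\<in>F j. z i))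
        \<and> disjoint_family_on F {..<2 * c - 1}"
    proof (rule disjoint_blocks_exist[where L = "2 * p - 1"])
      fix J assume "J \<subseteq> I" "finite J" "2 * p - 1 \<le> card J"
      then obtain J' where "J' \<subseteq> J" "card J' = 2 * p - 1" "finite J'"
        using obtain_subset_with_card_n by blast
      then show "\<exists>T\<subseteq>J. card T = p \<and> int p dvd (\<Sum>i\<in>T. z i)"
        using erdos_ginzburg_ziv_prime[OF p(1), of J' z] by blast
    next
      have "2 * p - 1 + (2 * c - 1) * p = 2 * a - 1 + p"
        using c0 p1 c by (cases c) (auto simp: algebra_simps)
      then show "2 * p - 1 + (2 * c - 1) * p \<le> card I + p" using less.prems by simp
    qed (use p1 less.prems in auto)
    then obtain F where F: "\<And>j. j < 2 * c - 1 \<Longrightarrow> F j \<subseteq> I \<and> card (F j) = p \<and> int p dvd (\<Sum>i\<in>F j. z i)"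
      "disjoint_family_on F {..<2 * c - 1}" by blast
    define y where "y j = (\<Sum>i\<in>F j. z i) div int p" for j
    obtain A where A: "A \<subseteq> {..<2 * c - 1}" "card A = c" "int c dvd (\<Sum>j\<in>A. y j)"
      using less.IH[OF c0(2,1), of "{..<2 * c - 1}" y] by auto
    define T where "T = (\<Union>j\<in>A. F j)"
    have finF: "finite (F j)" if "j < 2 * c - 1" for j
      using F(1)[OF that] less.prems(2) finite_subset by blast
    have finA: "finite A" using A(1) finite_subset by blast
    have "card T = a"
      unfolding T_def using card_UN_blocks[OF A(1) _ F(2), of p] F finF A c by simp
    moreover have "T \<subseteq> I" using A F unfolding T_def by blast
    moreover have "(\<Sum>i\<in>T. z i) = (\<Sum>j\<in>A. \<Sum>i\<in>F j. z i)"
      unfolding T_def using finA A(1) finF F(2)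
      by (intro sum.UNION_disjoint) (auto simp: disjoint_family_on_def subset_iff)
    moreover have "\<dots> = (\<Sum>j\<in>A. int p * y j)"
      using A F by (intro sum.cong) (auto simp: y_def)
    moreover have "int a dvd (\<Sum>j\<in>A. int p * y j)"
      using A(3) c by (simp add: sum_distrib_left[symmetric])
    ultimately show ?thesis by metis
  qed
qed

section \<open>The exponent and the Erdos-Ginzburg-Ziv constant\<close>

text \<open>The number \<open>N\<close> guarantees that the \<open>LEAST\<close> exists. If
  \<open>m\<close> annihilates the group, so does its remainder modulo the exponent, which by
  minimality is 0.\<close>

lemma group_exp_props:
  assumes "group G" and N: "N > 0" "\<And>x. x \<in> carrier G \<Longrightarrow> x [^]\<^bsub>G\<^esub> (N::nat) = \<one>\<^bsub>G\<^esub>"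
  shows "group_exp G > 0"
    and "\<And>m::nat. (\<forall>x\<in>carrier G. x [^]\<^bsub>G\<^esub> m = \<one>\<^bsub>G\<^esub>) \<longleftrightarrow> group_exp G dvd m"
proof -
  interpret group G by fact
  define P where "P n \<longleftrightarrow> n > 0 \<and> (\<forall>x\<in>carrier G. x [^]\<^bsub>G\<^esub> n = \<one>\<^bsub>G\<^esub>)" for n :: nat
  have exp: "group_exp G = (LEAST n. P n)" by (simp add: group_exp_def P_def)
  have "P N" using N by (simp add: P_def)
  then have P: "P (group_exp G)" unfolding exp by (rule LeastI)
  then show pos: "group_exp G > 0" by (simp add: P_def)
  fix m :: nat
  show "(\<forall>x\<in>carrier G. x [^]\<^bsub>G\<^esub> m = \<one>\<^bsub>G\<^esub>) \<longleftrightarrow> group_exp G dvd m"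
  proof
    assume m: "\<forall>x\<in>carrier G. x [^]\<^bsub>G\<^esub> m = \<one>\<^bsub>G\<^esub>"
    have "x [^]\<^bsub>G\<^esub> (m mod group_exp G) = \<one>\<^bsub>G\<^esub>" if x: "x \<in> carrier G" for x
    proof -
      have "ord x dvd m" "ord x dvd group_exp G"
        using m P x by (auto simp: P_def pow_eq_id)
      then show ?thesis using x by (simp add: pow_eq_id dvd_mod)
    qed
    moreover have "\<not> P (m mod group_exp G)"
      using pos not_less_Least[of "m mod group_exp G" P] by (simp add: exp[symmetric])
    ultimately show "group_exp G dvd m" by (auto simp: P_def mod_eq_0_iff_dvd)
  next
    assume "group_exp G dvd m"
    then show "\<forall>x\<in>carrier G. x [^]\<^bsub>G\<^esub> m = \<one>\<^bsub>G\<^esub>"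
      using P by (auto simp: P_def pow_eq_id intro: dvd_trans)
  qed
qed

text \<open>Replaces multisets by families indexed by natural numbers, through the positions in a
  list of the terms.\<close>

lemma egz_const_le:
  assumes G: "comm_group G" and N: "N > 0"
    and ex: "\<And>(I :: nat set) s. \<lbrakk>finite I; N \<le> card I; s \<in> I \<rightarrow> carrier G\<rbrakk>
      \<Longrightarrow> \<exists>T\<subseteq>I. card T = group_exp G \<and> finprod G s T = \<one>\<^bsub>G\<^esub>"
  shows "egz_const G \<le> N"
  unfolding egz_const_def
proof (rule Least_le, intro conjI allI impI)
  interpret comm_group G by fact
  fix S assume S: "seq_over G S \<and> N \<le> size S"
  obtain xs where xs: "mset xs = S" using ex_mset by blast
  have s: "(!) xs \<in> {..<length xs} \<rightarrow> carrier G"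
    using S xs by (auto simp: seq_over_def)
  obtain T where T: "T \<subseteq> {..<length xs}" "card T = group_exp G" "finprod G ((!) xs) T = \<one>\<^bsub>G\<^esub>"
    using ex[OF _ _ s] S xs by auto
  have fT: "finite T" using T(1) finite_subset by blast
  have "seq_sum G (image_mset ((!) xs) (mset_set T)) = \<one>\<^bsub>G\<^esub>"
    using T s fT by (subst seq_sum_image_mset) auto
  then show "\<exists>T. T \<subseteq># S \<and> seq_sum G T = \<one>\<^bsub>G\<^esub> \<and> size T = group_exp G"
    using image_mset_nth_subset[OF T(1)] xs T(2)
    by (intro exI[of _ "image_mset ((!) xs) (mset_set T)"]) simp
qed fact

lemma iso_finprod:
  assumes "comm_group G" "comm_group K" "\<phi> \<in> iso G K" "s \<in> T \<rightarrow> carrier G"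
  shows "\<phi> (finprod G s T) = finprod K (\<phi> \<circ> s) T"
proof -
  interpret G: comm_group G by fact
  interpret K: comm_group K by fact
  interpret \<phi>: group_hom G K \<phi>
    using assms(3) by unfold_locales (simp add: iso_def)
  show ?thesis using assms(4)
  proof (induction T rule: infinite_finite_induct)
    case (insert t T)
    moreover from insert have "\<phi> \<circ> s \<in> T \<rightarrow> carrier K" "\<phi> (s t) \<in> carrier K"
      by (auto simp: Pi_iff)
    ultimately show ?case by (simp add: Pi_iff)
  qed auto
qed

text \<open>The exponent is determined by which \<open>m\<close> annihilate the group. Through the
  isomorphism these are the common multiples of \<open>group_exp H\<close> and \<open>a\<close>,
  that is, the multiples of their product by coprimality.\<close>

lemma group_exp_iso_DirProd:
  assumes H: "comm_group H" and G: "comm_group G" and iso: "\<phi> \<in> iso G (H \<times>\<times> integer_mod_group a)"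
    and a: "a > 0" and N: "N > 0" "\<And>x. x \<in> carrier H \<Longrightarrow> x [^]\<^bsub>H\<^esub> (N::nat) = \<one>\<^bsub>H\<^esub>"
    and cop: "coprime (group_exp H) a"
  shows "group_exp G = group_exp H * a"
proof -
  interpret G: comm_group G by fact
  interpret H: comm_group H by fact
  define M where "M = H \<times>\<times> integer_mod_group a"
  interpret M: comm_group M unfolding M_def by (intro comm_group_DirProd H) simp
  interpret \<phi>: group_hom G M \<phi>
    using iso by unfold_locales (simp add: iso_def M_def)
  have bij: "bij_betw \<phi> (carrier G) (carrier M)" using iso by (simp add: iso_def M_def)
  note expH = group_exp_props[OF H.is_group N]
  have pow: "(g, z) [^]\<^bsub>M\<^esub> m = (g [^]\<^bsub>H\<^esub> m, int m * z mod int a)"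
    if "g \<in> carrier H" "z \<in> carrier (integer_mod_group a)" for g z and m :: nat
    unfolding M_def using that by (subst pow_DirProd) (auto simp: H)
  have iff: "(\<forall>x\<in>carrier G. x [^]\<^bsub>G\<^esub> m = \<one>\<^bsub>G\<^esub>) \<longleftrightarrow> group_exp H * a dvd m" for m :: nat
  proof -
    have "(\<forall>x\<in>carrier G. x [^]\<^bsub>G\<^esub> m = \<one>\<^bsub>G\<^esub>) \<longleftrightarrow> (\<forall>x\<in>carrier G. \<phi> x [^]\<^bsub>M\<^esub> m = \<one>\<^bsub>M\<^esub>)"
    proof (rule ball_cong[OF refl])
      fix x assume x: "x \<in> carrier G"
      have "x [^]\<^bsub>G\<^esub> m = \<one>\<^bsub>G\<^esub> \<longleftrightarrow> \<phi> (x [^]\<^bsub>G\<^esub> m) = \<phi> \<one>\<^bsub>G\<^esub>"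
        using bij x by (metis G.nat_pow_closed G.one_closed bij_betw_imp_inj_on inj_onD)
      then show "x [^]\<^bsub>G\<^esub> m = \<one>\<^bsub>G\<^esub> \<longleftrightarrow> \<phi> x [^]\<^bsub>M\<^esub> m = \<one>\<^bsub>M\<^esub>"
        using x by (simp add: \<phi>.hom_nat_pow)
    qed
    also have "\<dots> \<longleftrightarrow> (\<forall>y\<in>carrier M. y [^]\<^bsub>M\<^esub> m = \<one>\<^bsub>M\<^esub>)"
      using bij by (metis (no_types, lifting) bij_betw_imp_surj_on image_iff)
    also have "\<dots> \<longleftrightarrow> (\<forall>g\<in>carrier H. g [^]\<^bsub>H\<^esub> m = \<one>\<^bsub>H\<^esub>)
        \<and> (\<forall>z\<in>carrier (integer_mod_group a). int m * z mod int a = 0)"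
    proof -
      have "(\<forall>y\<in>carrier M. y [^]\<^bsub>M\<^esub> m = \<one>\<^bsub>M\<^esub>) \<longleftrightarrow> (\<forall>g\<in>carrier H. \<forall>z\<in>carrier (integer_mod_group a).
          g [^]\<^bsub>H\<^esub> m = \<one>\<^bsub>H\<^esub> \<and> int m * z mod int a = 0)"
        using pow by (simp add: M_def)
      then show ?thesis using H.one_closed integer_mod_group_0[of a] by blast
    qed
    also have "(\<forall>z\<in>carrier (integer_mod_group a). int m * z mod int a = 0) \<longleftrightarrow> a dvd m"
    proof
      assume "\<forall>z\<in>carrier (integer_mod_group a). int m * z mod int a = 0"
      then have "int m * (1 mod int a) mod int a = 0"
        using a by (simp add: mod_in_carrier_integer_mod_group)
      then show "a dvd m" by (simp add: mod_mult_right_eq flip: dvd_eq_mod_eq_0)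
    qed (auto simp: mod_eq_0_iff_dvd)
    also have "(\<forall>g\<in>carrier H. g [^]\<^bsub>H\<^esub> m = \<one>\<^bsub>H\<^esub>) \<longleftrightarrow> group_exp H dvd m" by (rule expH)
    also have "group_exp H dvd m \<and> a dvd m \<longleftrightarrow> group_exp H * a dvd m"
      using cop by (auto intro: divides_mult dvd_mult_left dvd_mult_right)
    finally show ?thesis .
  qed
  have pos: "group_exp H * a > 0" using expH(1) a by simp
  have "x [^]\<^bsub>G\<^esub> (group_exp H * a) = \<one>\<^bsub>G\<^esub>" if "x \<in> carrier G" for x
    using iff[of "group_exp H * a"] that by simp
  from group_exp_props(2)[OF G.is_group pos this] iff
  have "group_exp G dvd m \<longleftrightarrow> group_exp H * a dvd m" for m by blast
  then show ?thesis by (meson dvd_antisym dvd_refl)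
qed

theorem theorem2p4:
  fixes p k a :: nat
    and H :: "('a, 'm) monoid_scheme"
    and G :: "('b, 'n) monoid_scheme"
  assumes "Factorial_Ring.prime p" and "p \<ge> 3"
    and "comm_group H" and "finite (carrier H)" and "\<exists>n. order H = p ^ n"
    and "int (davenport H) \<le> 2 * int (group_exp H) - int (p ^ k)"
    and "p ^ k \<le> group_exp H"
    and "a > 0" and "coprime a p"
    and "comm_group G" and "G \<cong> H \<times>\<times> integer_mod_group a"
  shows "int (egz_const G) \<le> int (davenport H) + 2 * int (group_exp G) - int (p ^ k) - 1"
proof -
  note p = assms(1)
  interpret H: comm_group H by fact
  interpret G: comm_group G by fact
  obtain r where r: "order H = p ^ r" using assms(5) by blast
  have pr: "x [^]\<^bsub>H\<^esub> (p ^ r) = \<one>\<^bsub>H\<^esub>" if "x \<in> carrier H" for x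
    using H.pow_order_eq_1[OF that] r by simp
  have p0: "p > 0" using p by (rule prime_gt_0_nat)
  have "odd p" using p assms(2) by (intro prime_odd_nat) auto
  define n q d where "n = group_exp H" and "q = p ^ k" and "d = davenport H"
  have expH: "n > 0" "n dvd p ^ r"
    using group_exp_props[OF H.is_group, of "p ^ r"] pr p0 by (auto simp: n_def)
  obtain e where e: "n = p ^ e" using expH(2) divides_primepow_nat[OF p] by blast
  have van: "H.altsum_vanishes p d" and "d > 0"
    unfolding d_def using H.altsum_vanishes_davenport[OF p assms(4) pr] by auto
  have dq: "d + q \<le> 2 * n" "q \<le> n"
    using assms(6,7) unfolding d_def q_def n_def by linarith+
  obtain \<phi> where \<phi>: "\<phi> \<in> iso G (H \<times>\<times> integer_mod_group a)"
    using assms(11) by (auto simp: is_iso_def)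
  have expG: "group_exp G = n * a"
    unfolding n_def
  proof (rule group_exp_iso_DirProd[OF assms(3,10) \<phi> assms(8) _ pr])
    show "coprime (group_exp H) a"
      using assms(9) e by (simp add: n_def coprime_commute)
  qed (use p0 in auto)
  define N where "N = d + 2 * (n * a) - q - 1"
  have "n \<le> n * a" using assms(8) by simp
  \<comment> \<open>The truncated subtraction in \<open>N\<close> is exact, since
    \<open>q \<le> n \<le> n * a\<close> and \<open>d > 0\<close>.\<close>
  have N: "N + q + 1 = d + 2 * (n * a)" "N > 0"
    using dq \<open>d > 0\<close> \<open>n \<le> n * a\<close> expH(1) unfolding N_def by linarith+
  have "egz_const G \<le> N"
  proof (rule egz_const_le[OF assms(10) N(2)])
    fix I :: "nat set" and s assume I: "finite I" "N \<le> card I" and s: "s \<in> I \<rightarrow> carrier G"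
    define M where "M = H \<times>\<times> integer_mod_group a"
    have bij: "bij_betw \<phi> (carrier G) (carrier M)" using \<phi> by (simp add: iso_def M_def)
    then have \<phi>M: "\<phi> x \<in> carrier M" if "x \<in> carrier G" for x
      using that by (rule bij_betw_apply)
    define h z where "h i = fst (\<phi> (s i))" and "z i = snd (\<phi> (s i))" for i
    have hz: "h i \<in> carrier H" "z i \<in> carrier (integer_mod_group a)" if "i \<in> I" for i
      using \<phi>M[of "s i"] s that by (auto simp: h_def z_def M_def mem_Times_iff)
    have "\<exists>F. (\<forall>j<2 * a - 1. F j \<subseteq> I \<and> card (F j) = n \<and> finprod H h (F j) = \<one>\<^bsub>H\<^esub>)
        \<and> disjoint_family_on F {..<2 * a - 1}"
    \<comment> \<open>A block needs \<open>L = d + 2 * n - q - 1\<close> available positions by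
      \<open>zero_sum_subset_exists\<close>, and \<open>L + (2 * a - 2) * n\<close> is exactly
      \<open>N\<close>.\<close>
    proof (rule disjoint_blocks_exist[where L = "d + 2 * n - q - 1"])
      fix J assume J: "J \<subseteq> I" "finite J" "d + 2 * n - q - 1 \<le> card J"
      then have "H.zero_sum_subsets h J n \<noteq> {}"
        using hz by (intro H.zero_sum_subset_exists[OF p \<open>odd p\<close> e q_def dq(2) van dq(1)]) auto
      then show "\<exists>T\<subseteq>J. card T = n \<and> finprod H h T = \<one>\<^bsub>H\<^esub>"
        by (auto simp: H.zero_sum_subsets_def)
    next
      have "(2 * a - 1) * n + n = 2 * (n * a)"
        using assms(8) by (cases a) (auto simp: algebra_simps)
      then show "d + 2 * n - q - 1 + (2 * a - 1) * n \<le> card I + n"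
        using I(2) N dq \<open>d > 0\<close> expH(1) by linarith
    qed (use expH I in auto)
    then obtain F where F: "\<And>j. j < 2 * a - 1 \<Longrightarrow> F j \<subseteq> I \<and> card (F j) = n \<and> finprod H h (F j) = \<one>\<^bsub>H\<^esub>"
      "disjoint_family_on F {..<2 * a - 1}" by blast
    \<comment> \<open>The blocks are already trivial in \<open>H\<close>; among their
      \<open>2 * a - 1\<close> sums in \<open>C_a\<close>, some \<open>a\<close> add up to 0. Their
      union has \<open>a * n\<close> positions, which is the exponent of \<open>G\<close>.\<close>
    obtain A where A: "A \<subseteq> {..<2 * a - 1}" "card A = a" "int a dvd (\<Sum>j\<in>A. \<Sum>i\<in>F j. z i)"
      using erdos_ginzburg_ziv[OF assms(8), of "{..<2 * a - 1}" "\<lambda>j. \<Sum>i\<in>F j. z i"] by auto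
    have finF: "finite (F j)" if "j < 2 * a - 1" for j
      using F(1)[OF that] I(1) finite_subset by blast
    have finA: "finite A" using A(1) finite_subset by blast
    define T where "T = (\<Union>j\<in>A. F j)"
    have TI: "T \<subseteq> I" using A F unfolding T_def by blast
    have sT: "s \<in> T \<rightarrow> carrier G" using s TI by auto
    have cardT: "card T = group_exp G"
      unfolding T_def expG using card_UN_blocks[OF A(1) _ F(2), of n] F finF A by simp
    have "finprod H h T = finprod H (\<lambda>j. finprod H h (F j)) A"
      unfolding T_def using finA A(1) finF F hz
      by (intro H.finprod_UN_disjoint) (auto simp: disjoint_family_on_def pairwise_def disjnt_def subset_iff)
    also have "\<dots> = \<one>\<^bsub>H\<^esub>" using A F by (intro H.finprod_one_eqI[of A]) blast
    finally have hT: "finprod H h T = \<one>\<^bsub>H\<^esub>" .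
    have "(\<Sum>i\<in>T. z i) = (\<Sum>j\<in>A. \<Sum>i\<in>F j. z i)"
      unfolding T_def using finA A(1) finF F(2)
      by (intro sum.UNION_disjoint) (auto simp: disjoint_family_on_def subset_iff)
    then have zT: "finprod (integer_mod_group a) z T = 0"
      using A(3) hz TI assms(8) by (subst finprod_integer_mod_group) auto
    have "\<phi> (finprod G s T) = finprod M (\<phi> \<circ> s) T"
      unfolding M_def by (rule iso_finprod[OF assms(10) _ \<phi> sT]) (intro comm_group_DirProd assms(3), simp)
    also have "\<dots> = (finprod H (fst \<circ> (\<phi> \<circ> s)) T, finprod (integer_mod_group a) (snd \<circ> (\<phi> \<circ> s)) T)"
      unfolding M_def using \<phi>M sT by (intro finprod_DirProd assms(3)) (auto simp: M_def Pi_iff)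
    also have "fst \<circ> (\<phi> \<circ> s) = h" by (auto simp: h_def)
    also have "snd \<circ> (\<phi> \<circ> s) = z" by (auto simp: z_def)
    also have "(finprod H h T, finprod (integer_mod_group a) z T) = \<one>\<^bsub>M\<^esub>"
      using hT zT by (simp add: M_def)
    \<comment> \<open>Both coordinates are trivial, so injectivity of \<open>\<phi>\<close> gives
      the claim in \<open>G\<close>.\<close>
    also have "\<dots> = \<phi> \<one>\<^bsub>G\<^esub>"
      using hom_one[of \<phi> G M] \<phi> G.is_group DirProd_group[OF H.is_group group_integer_mod_group]
      by (auto simp: M_def iso_def)
    finally have "finprod G s T = \<one>\<^bsub>G\<^esub>"
      by (rule inj_onD[OF bij_betw_imp_inj_on[OF bij]]) (use sT in auto)
    then show "\<exists>T\<subseteq>I. card T = group_exp G \<and> finprod G s T = \<one>\<^bsub>G\<^esub>"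
      using TI cardT by blast
  qed
  then show ?thesis using N(1) expG unfolding d_def q_def by linarith
qed

end
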